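(* Let $\mathfrak{A}$ be a unital AF algebra with unit $1_{\mathfrak{A}}$. Let $\mathcal{U}=(\mathfrak{A}_n)_{n\in\mathbb{N}}$ be an increasing sequence of unital finite dimensional C*-subalgebras such that $\mathfrak{A}=\overline{\cup_{n\in\mathbb{N}}\mathfrak{A}_n}^{\|\cdot\|_{\mathfrak{A}}}$ with $\mathfrak{A}_0=\mathbb{C}1_{\mathfrak{A}}$. Let $\mathfrak{B}$ be a unital AF algebra with unit $1_{\mathfrak{B}}$, and let $\mathcal{V}=(\mathfrak{B}_n)_{n\in\mathbb{N}}$ be an increasing sequence of unital finite dimensional C*-subalgebras such that $\mathfrak{B}=\overline{\cup_{n\in\mathbb{N}}\mathfrak{B}_n}^{\|\cdot\|_{\mathfrak{B}}}$ with $\mathfrak{B}_0=\mathbb{C}1_{\mathfrak{B}}$. Let $\beta:\mathbb{N}\to(0,\infty)$ have limit $0$ at infinity. Let $\overline{\mathsf{L}^\beta_{\mathcal{U}}}$, $\overline{\mathsf{L}^\beta_{\mathcal{V}}}$ denote the associated closed quotient-norm Lip-norms on $\mathfrak{A}$, $\mathfrak{B}$ respectively. If $\phi:\mathfrak{A}\hookrightarrow\mathfrak{B}$ is a unital *-monomorphism such that $\phi(\mathfrak{A}_n)=\mathfrak{B}_n$ for all $n\in\mathbb{N}$, then there exists a quantum isometry from $(\mathfrak{A},\overline{\mathsf{L}^\beta_{\mathcal{U}}})$ to $(\mathfrak{B},\overline{\mathsf{L}^\beta_{\mathcal{V}}})$ and thus $$\mathsf{\Lambda}_{1,0}\left((\mathfrak{A},\overline{\mathsf{L}^\beta_{\mathcal{U}}}),(\mathfrak{B},\overline{\mathsf{L}^\beta_{\mathcal{V}}})\right)=0.$$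 Moreover, $$\mathsf{\Lambda}_{1,0}\left((\mathfrak{A}_n,\overline{\mathsf{L}^\beta_{\mathcal{U}}}),(\mathfrak{B}_n,\overline{\mathsf{L}^\beta_{\mathcal{V}}})\right)=0\quad\text{for all }n\in\mathbb{N}.$$
   Context: **The Lip-norms.** For $a\in\mathfrak{sa}(\mathfrak{A})$, $\mathsf{L}^\beta_{\mathcal{U}}(a)=\sup\{S_n(a)/\beta(n):n\in\mathbb{N}\}\in[0,\infty]$, where $S_n(a)=\inf\{\|a-b\|_{\mathfrak{A}}:b\in\mathfrak{A}_n\}$ is the quotient norm of $\mathfrak{A}/\mathfrak{A}_n$. Let $L_{f,1}$ be the norm closure of $\{a\in\mathfrak{sa}(\cup_{n\in\mathbb{N}}\mathfrak{A}_n):\mathsf{L}^\beta_{\mathcal{U}}(a)\leq1\}$; then $\overline{\mathsf{L}^\beta_{\mathcal{U}}}(a)=\inf\{r>0:\frac1r a\in L_{f,1}\}$ for $a\in\mathfrak{sa}(\mathfrak{A})$ (with $\inf\emptyset=\infty$). $\overline{\mathsf{L}^\beta_{\mathcal{V}}}$ is defined in the same way from $\mathfrak{B},\mathcal{V}$. The pairs $(\mathfrak{A},\overline{\mathsf{L}^\beta_{\mathcal{U}}})$ and $(\mathfrak{A}_n,\overline{\mathsf{L}^\beta_{\mathcal{U}}})$ (restricted to $\mathfrak{sa}(\mathfrak{A}_n)$) are $(1,0)$-quasi-Leibniz quantum compact metric spaces. The subalgebras $\mathfrak{A}_n$ (resp. $\mathfrak{B}_n$) contain $1_{\mathfrak{A}}$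 (resp. $1_{\mathfrak{B}}$). A quantum isometry $(\mathfrak{A},\mathsf{L}_{\mathfrak{A}})\to(\mathfrak{B},\mathsf{L}_{\mathfrak{B}})$ is a *-isomorphism $\pi:\mathfrak{A}\to\mathfrak{B}$ with $\mathsf{L}_{\mathfrak{B}}\circ\pi=\mathsf{L}_{\mathfrak{A}}$. **Quantum compact metric spaces.** For a unital C*-algebra $\mathfrak{A}$: $1_{\mathfrak{A}}$ is its unit, $\mathfrak{sa}(\mathfrak{A})$ its self-adjoint part, $\mathscr{S}(\mathfrak{A})$ its state space. For $C\geq1$, $D\geq0$, a $(C,D)$-quasi-Leibniz quantum compact metric space $(\mathfrak{A},\mathsf{L})$ is a unital C*-algebra $\mathfrak{A}$ with a seminorm $\mathsf{L}:\mathfrak{sa}(\mathfrak{A})\to[0,\infty]$ such that $\mathrm{dom}(\mathsf{L})=\{a\in\mathfrak{sa}(\mathfrak{A}):\mathsf{L}(a)<\infty\}$ is a dense unital Jordan-Lie subalgebra of $\mathfrak{sa}(\mathfrak{A})$ and: (i) $\{a:\mathsf{L}(a)=0\}=\mathbb{R}1_{\mathfrak{A}}$; (ii) for all $a,b\in\mathrm{dom}(\mathsf{L})$, $\max\{\mathsf{L}(\frac{ab+ba}{2}),\mathsf{L}(\frac{ab-ba}{2i})\}\leq C(\|a\|\mathsf{L}(b)+\|b\|\mathsf{L}(a))+D\mathsf{L}(a)\mathsf{L}(b)$; (iii) the metric $\mathsf{mk}_{\mathsf{L}}(\varphi,\psi)=\sup\{|\varphi(a)-\psi(a)|:a\in\mathrm{dom}(\mathsf{L}),\mathsf{L}(a)\leq1\}$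 metrizes the weak* topology of $\mathscr{S}(\mathfrak{A})$; (iv) $\mathsf{L}$ is lower semi-continuous for $\|\cdot\|_{\mathfrak{A}}$. **Quantum propinquity.** A bridge $\gamma=(\mathfrak{D},\pi_{\mathfrak{A}},\pi_{\mathfrak{B}},\omega)$ from $\mathfrak{A}$ to $\mathfrak{B}$ consists of a unital C*-algebra $\mathfrak{D}$, unital *-monomorphisms $\pi_{\mathfrak{A}}:\mathfrak{A}\to\mathfrak{D}$, $\pi_{\mathfrak{B}}:\mathfrak{B}\to\mathfrak{D}$ and $\omega\in\mathfrak{D}$ such that $\mathscr{S}_1(\mathfrak{D}|\omega)=\{\varphi\in\mathscr{S}(\mathfrak{D}):\varphi(1-\omega^*\omega)=\varphi(1-\omega\omega^* )=0\}\neq\emptyset$. Its height is the maximum of the Hausdorff distances, for $\mathsf{mk}_{\mathsf{L}_{\mathfrak{A}}}$ and $\mathsf{mk}_{\mathsf{L}_{\mathfrak{B}}}$ respectively, between $\mathscr{S}(\mathfrak{A})$ and $\{\varphi\circ\pi_{\mathfrak{A}}:\varphi\in\mathscr{S}_1(\mathfrak{D}|\omega)\}$, and between $\mathscr{S}(\mathfrak{B})$ and $\{\varphi\circ\pi_{\mathfrak{B}}:\varphi\in\mathscr{S}_1(\mathfrak{D}|\omega)\}$. Its reach is the Hausdorff distance between $\{a\in\mathfrak{sa}(\mathfrak{A}):\mathsf{L}_{\mathfrak{A}}(a)\leq1\}$ and $\{b\in\mathfrak{sa}(\mathfrak{B}):\mathsf{L}_{\mathfrak{B}}(b)\leq1\}$,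 where the distance from $a$ to $b$ is $\|\pi_{\mathfrak{A}}(a)\omega-\omega\pi_{\mathfrak{B}}(b)\|_{\mathfrak{D}}$. Its length is the maximum of height and reach. The quantum propinquity $\mathsf{\Lambda}_{C,D}$ is the largest $[0,\infty)$-valued function on pairs of $(C,D)$-quasi-Leibniz quantum compact metric spaces that is symmetric, satisfies the triangle inequality, and is at most the length of $\gamma$ for every bridge $\gamma$ between the two spaces (equivalently, the infimum, over finite chains of such spaces joined by bridges, of the sum of the lengths of the bridges). It is known to be zero exactly when there is a quantum isometry between the two spaces. *)

theory Defs
  imports "HOL-Analysis.Analysis" "HOL-Algebra.Module" "HOL-Algebra.Subrings"
begin

section \<open>Unital C*-algebras on an explicit carrier\<close>

definition complex_ring :: "complex ring" where
  "complex_ring = \<lparr>carrier = UNIV, monoid.mult = (*), one = 1, zero = 0, add = (+)\<rparr>"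

record 'a cstar = "(complex, 'a) module" +
  star :: "'a \<Rightarrow> 'a"
  cnorm :: "'a \<Rightarrow> real"

text \<open>
  The library locale for abstract metric spaces wants a distance that is nonnegative and
  symmetric on the whole type, hence the cut-off outside the carrier.
\<close>

definition cdist :: "'a cstar \<Rightarrow> 'a \<Rightarrow> 'a \<Rightarrow> real" where
  "cdist A x y =
     (if x \<in> carrier A \<and> y \<in> carrier A then cnorm A (x \<ominus>\<^bsub>A\<^esub> y) else 0)"

abbreviation norm_topology :: "'a cstar \<Rightarrow> 'a topology" where
  "norm_topology A \<equiv> Metric_space.mtopology (carrier A) (cdist A)"

text \<open>Unital C*-algebras are taken to be nonzero, so that state spaces are nonempty.\<close>

locale cstar_algebra = module complex_ring A + ring A for A :: "'a cstar" (structure) +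
  assumes one_neq_zero: "\<one> \<noteq> \<zero>"
    and smult_mult_left:
      "\<lbrakk>x \<in> carrier A; y \<in> carrier A\<rbrakk> \<Longrightarrow> (c \<odot> x) \<otimes> y = c \<odot> (x \<otimes> y)"
    and smult_mult_right:
      "\<lbrakk>x \<in> carrier A; y \<in> carrier A\<rbrakk> \<Longrightarrow> x \<otimes> (c \<odot> y) = c \<odot> (x \<otimes> y)"
    and star_closed: "x \<in> carrier A \<Longrightarrow> star A x \<in> carrier A"
    and star_star: "x \<in> carrier A \<Longrightarrow> star A (star A x) = x"
    and star_add:
      "\<lbrakk>x \<in> carrier A; y \<in> carrier A\<rbrakk> \<Longrightarrow> star A (x \<oplus> y) = star A x \<oplus> star A y"
    and star_smult: "x \<in> carrier A \<Longrightarrow> star A (c \<odot> x) = cnj c \<odot> star A x"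
    and star_mult:
      "\<lbrakk>x \<in> carrier A; y \<in> carrier A\<rbrakk> \<Longrightarrow> star A (x \<otimes> y) = star A y \<otimes> star A x"
    and cnorm_eq_zero: "x \<in> carrier A \<Longrightarrow> cnorm A x = 0 \<longleftrightarrow> x = \<zero>"
    and cnorm_triangle:
      "\<lbrakk>x \<in> carrier A; y \<in> carrier A\<rbrakk> \<Longrightarrow> cnorm A (x \<oplus> y) \<le> cnorm A x + cnorm A y"
    and cnorm_smult: "x \<in> carrier A \<Longrightarrow> cnorm A (c \<odot> x) = cmod c * cnorm A x"
    and cnorm_mult:
      "\<lbrakk>x \<in> carrier A; y \<in> carrier A\<rbrakk> \<Longrightarrow> cnorm A (x \<otimes> y) \<le> cnorm A x * cnorm A y"
    and cstar_identity: "x \<in> carrier A \<Longrightarrow> cnorm A (star A x \<otimes> x) = (cnorm A x)\<^sup>2"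
    and complete: "Metric_space.mcomplete (carrier A) (cdist A)"

definition sa :: "'a cstar \<Rightarrow> 'a set" where
  "sa A = {a \<in> carrier A. star A a = a}"

text \<open>A unital C*-subalgebra S of A, seen as an algebra, is the record update of the carrier.\<close>

definition unital_cstar_subalgebra :: "'a set \<Rightarrow> 'a cstar \<Rightarrow> bool" where
  "unital_cstar_subalgebra S A \<longleftrightarrow>
     subring S A \<and> submodule S complex_ring A \<and> star A ` S \<subseteq> S \<and> closedin (norm_topology A) S"

definition finite_dimensional :: "'a cstar \<Rightarrow> bool" where
  "finite_dimensional A \<longleftrightarrow>
     (\<exists>F. finite F \<and> F \<subseteq> carrier A \<and>
        (\<forall>x\<in>carrier A. \<exists>c. x = (\<Oplus>\<^bsub>A\<^esub>f\<in>F. c f \<odot>\<^bsub>A\<^esub> f)))"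

text \<open>The library's ring homomorphisms preserve the unit.\<close>

definition star_hom :: "'a cstar \<Rightarrow> 'b cstar \<Rightarrow> ('a \<Rightarrow> 'b) set" where
  "star_hom A B = {\<pi> \<in> ring_hom A B.
     (\<forall>c. \<forall>x\<in>carrier A. \<pi> (c \<odot>\<^bsub>A\<^esub> x) = c \<odot>\<^bsub>B\<^esub> \<pi> x) \<and>
     (\<forall>x\<in>carrier A. \<pi> (star A x) = star B (\<pi> x))}"

definition star_mono :: "'a cstar \<Rightarrow> 'b cstar \<Rightarrow> ('a \<Rightarrow> 'b) set" where
  "star_mono A B = {\<pi> \<in> star_hom A B. inj_on \<pi> (carrier A)}"

definition star_iso :: "'a cstar \<Rightarrow> 'b cstar \<Rightarrow> ('a \<Rightarrow> 'b) set" where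
  "star_iso A B = {\<pi> \<in> star_hom A B. bij_betw \<pi> (carrier A) (carrier B)}"

text \<open>
  States are positive linear functionals with value 1 at the unit. They are normalised to be
  extensional, so that two states are equal iff they agree on the carrier.
\<close>

definition states :: "'a cstar \<Rightarrow> ('a \<Rightarrow> complex) set" where
  "states A = {\<phi> \<in> extensional (carrier A).
     (\<forall>x\<in>carrier A. \<forall>y\<in>carrier A. \<phi> (x \<oplus>\<^bsub>A\<^esub> y) = \<phi> x + \<phi> y) \<and>
     (\<forall>c. \<forall>x\<in>carrier A. \<phi> (c \<odot>\<^bsub>A\<^esub> x) = c * \<phi> x) \<and>
     (\<forall>x\<in>carrier A. \<phi> (star A x \<otimes>\<^bsub>A\<^esub> x) \<in> \<real>\<^sub>\<ge>\<^sub>0) \<and>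
     \<phi> \<one>\<^bsub>A\<^esub> = 1}"

definition weak_star_topology :: "'a cstar \<Rightarrow> ('a \<Rightarrow> complex) topology" where
  "weak_star_topology A =
     subtopology (product_topology (\<lambda>_. euclidean) (carrier A)) (states A)"


section \<open>Quasi-Leibniz quantum compact metric spaces\<close>

type_synonym 'a lip_space = "'a cstar \<times> ('a \<Rightarrow> ennreal)"

text \<open>
  Only the values of the second component on the self-adjoint part are ever used; in
  particular a Lip-norm needs no explicit restriction when it is restricted to a subalgebra.
\<close>

definition lip_dom :: "'a cstar \<Rightarrow> ('a \<Rightarrow> ennreal) \<Rightarrow> 'a set" where
  "lip_dom A L = {a \<in> sa A. L a < \<infinity>}"

definition lip_ball :: "'a cstar \<Rightarrow> ('a \<Rightarrow> ennreal) \<Rightarrow> 'a set" where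
  "lip_ball A L = {a \<in> sa A. L a \<le> 1}"

definition mk :: "'a cstar \<Rightarrow> ('a \<Rightarrow> ennreal) \<Rightarrow> ('a \<Rightarrow> complex) \<Rightarrow> ('a \<Rightarrow> complex) \<Rightarrow> ennreal"
  where "mk A L \<phi> \<psi> = (SUP a\<in>lip_ball A L. ennreal (cmod (\<phi> a - \<psi> a)))"

definition jordan :: "'a cstar \<Rightarrow> 'a \<Rightarrow> 'a \<Rightarrow> 'a" where
  "jordan A a b = (1 / 2) \<odot>\<^bsub>A\<^esub> (a \<otimes>\<^bsub>A\<^esub> b \<oplus>\<^bsub>A\<^esub> b \<otimes>\<^bsub>A\<^esub> a)"

definition lie :: "'a cstar \<Rightarrow> 'a \<Rightarrow> 'a \<Rightarrow> 'a" where
  "lie A a b = (1 / (2 * \<i>)) \<odot>\<^bsub>A\<^esub> (a \<otimes>\<^bsub>A\<^esub> b \<ominus>\<^bsub>A\<^esub> b \<otimes>\<^bsub>A\<^esub> a)"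

locale quantum_compact_metric_space = cstar_algebra A
  for C D :: real and A :: "'a cstar" (structure) and L :: "'a \<Rightarrow> ennreal" +
  assumes seminorm_add: "\<lbrakk>a \<in> sa A; b \<in> sa A\<rbrakk> \<Longrightarrow> L (a \<oplus> b) \<le> L a + L b"
    and seminorm_smult:
      "a \<in> sa A \<Longrightarrow> L (complex_of_real r \<odot> a) = ennreal \<bar>r\<bar> * L a"
    and dom_dense: "sa A \<subseteq> norm_topology A closure_of lip_dom A L"
    and dom_one: "\<one> \<in> lip_dom A L"
    and dom_add: "\<lbrakk>a \<in> lip_dom A L; b \<in> lip_dom A L\<rbrakk> \<Longrightarrow> a \<oplus> b \<in> lip_dom A L"
    and dom_smult: "a \<in> lip_dom A L \<Longrightarrow> complex_of_real r \<odot> a \<in> lip_dom A L"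
    and dom_jordan: "\<lbrakk>a \<in> lip_dom A L; b \<in> lip_dom A L\<rbrakk> \<Longrightarrow> jordan A a b \<in> lip_dom A L"
    and dom_lie: "\<lbrakk>a \<in> lip_dom A L; b \<in> lip_dom A L\<rbrakk> \<Longrightarrow> lie A a b \<in> lip_dom A L"
    and kernel: "{a \<in> sa A. L a = 0} = {complex_of_real r \<odot> \<one> | r. True}"
    and quasi_Leibniz:
      "\<lbrakk>a \<in> lip_dom A L; b \<in> lip_dom A L\<rbrakk> \<Longrightarrow>
         max (L (jordan A a b)) (L (lie A a b)) \<le>
         ennreal C * (ennreal (cnorm A a) * L b + ennreal (cnorm A b) * L a)
           + ennreal D * L a * L b"
    and mk_finite: "\<lbrakk>\<phi> \<in> states A; \<psi> \<in> states A\<rbrakk> \<Longrightarrow> mk A L \<phi> \<psi> < \<infinity>"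
    and mk_metric: "Metric_space (states A) (\<lambda>\<phi> \<psi>. enn2real (mk A L \<phi> \<psi>))"
    and mk_metrizes:
      "Metric_space.mtopology (states A) (\<lambda>\<phi> \<psi>. enn2real (mk A L \<phi> \<psi>)) = weak_star_topology A"
    and lower_semicontinuous: "closedin (norm_topology A) {a \<in> sa A. L a \<le> r}"

definition quantum_isometry ::
  "'a lip_space \<Rightarrow> 'b lip_space \<Rightarrow> ('a \<Rightarrow> 'b) \<Rightarrow> bool" where
  "quantum_isometry X Y \<pi> \<longleftrightarrow>
     \<pi> \<in> star_iso (fst X) (fst Y) \<and> (\<forall>a\<in>sa (fst X). snd Y (\<pi> a) = snd X a)"


section \<open>Bridges and the quantum propinquity\<close>

definition states_1 :: "'d cstar \<Rightarrow> 'd \<Rightarrow> ('d \<Rightarrow> complex) set" where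
  "states_1 D w = {\<phi> \<in> states D.
     \<phi> (\<one>\<^bsub>D\<^esub> \<ominus>\<^bsub>D\<^esub> star D w \<otimes>\<^bsub>D\<^esub> w) = 0 \<and>
     \<phi> (\<one>\<^bsub>D\<^esub> \<ominus>\<^bsub>D\<^esub> w \<otimes>\<^bsub>D\<^esub> star D w) = 0}"

definition bridge ::
  "'a cstar \<Rightarrow> 'b cstar \<Rightarrow> 'd cstar \<Rightarrow> ('a \<Rightarrow> 'd) \<Rightarrow> ('b \<Rightarrow> 'd) \<Rightarrow> 'd \<Rightarrow> bool" where
  "bridge A B D \<pi> \<rho> w \<longleftrightarrow>
     cstar_algebra D \<and> \<pi> \<in> star_mono A D \<and> \<rho> \<in> star_mono B D \<and>
     w \<in> carrier D \<and> states_1 D w \<noteq> {}"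

text \<open>
  The distance function may relate points of two different sets, as it does in the reach
  of a bridge.
\<close>

definition hausdorff :: "('a \<Rightarrow> 'b \<Rightarrow> ennreal) \<Rightarrow> 'a set \<Rightarrow> 'b set \<Rightarrow> ennreal" where
  "hausdorff d S T =
     max (SUP s\<in>S. INF t\<in>T. d s t) (SUP t\<in>T. INF s\<in>S. d s t)"

definition half_height ::
  "'a lip_space \<Rightarrow> 'd cstar \<Rightarrow> ('a \<Rightarrow> 'd) \<Rightarrow> 'd \<Rightarrow> ennreal" where
  "half_height X D \<pi> w = hausdorff (mk (fst X) (snd X)) (states (fst X))
     {compose (carrier (fst X)) \<phi> \<pi> | \<phi>. \<phi> \<in> states_1 D w}"

definition bridge_height ::
  "'a lip_space \<Rightarrow> 'b lip_space \<Rightarrow> 'd cstar \<Rightarrow> ('a \<Rightarrow> 'd) \<Rightarrow> ('b \<Rightarrow> 'd) \<Rightarrow> 'd \<Rightarrow> ennreal"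
  where "bridge_height X Y D \<pi> \<rho> w = max (half_height X D \<pi> w) (half_height Y D \<rho> w)"

definition bridge_reach ::
  "'a lip_space \<Rightarrow> 'b lip_space \<Rightarrow> 'd cstar \<Rightarrow> ('a \<Rightarrow> 'd) \<Rightarrow> ('b \<Rightarrow> 'd) \<Rightarrow> 'd \<Rightarrow> ennreal"
  where "bridge_reach X Y D \<pi> \<rho> w = hausdorff
     (\<lambda>a b. ennreal (cnorm D (\<pi> a \<otimes>\<^bsub>D\<^esub> w \<ominus>\<^bsub>D\<^esub> w \<otimes>\<^bsub>D\<^esub> \<rho> b)))
     (lip_ball (fst X) (snd X)) (lip_ball (fst Y) (snd Y))"

definition bridge_length ::
  "'a lip_space \<Rightarrow> 'b lip_space \<Rightarrow> 'd cstar \<Rightarrow> ('a \<Rightarrow> 'd) \<Rightarrow> ('b \<Rightarrow> 'd) \<Rightarrow> 'd \<Rightarrow> ennreal"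
  where "bridge_length X Y D \<pi> \<rho> w =
     max (bridge_height X Y D \<pi> \<rho> w) (bridge_reach X Y D \<pi> \<rho> w)"

text \<open>
  The relation below says that X and Y are joined by a finite chain of bridges whose lengths
  sum to l, all spaces strictly between X and Y being (C,D)-quasi-Leibniz quantum compact
  metric spaces. The endpoints are not tested: the propinquity is a total function, meaningful
  on such spaces.

  All algebras in a chain live on subsets of a single type 'u. This does not change the infimum.
  Quantum compact metric spaces are separable because their state spaces are metrizable, and
  replacing the algebra of a bridge by the separable C*-subalgebra generated by the two images
  and the pivot does not change its length, since states extend from C*-subalgebras. So only
  algebras of the cardinality of the continuum are needed, and any type that carries a nonzero
  complex vector space has room for copies of all of them.
\<close>

inductive bridge_chain :: "real \<Rightarrow> real \<Rightarrow> 'u lip_space \<Rightarrow> 'u lip_space \<Rightarrow> ennreal \<Rightarrow> bool"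
  for C D :: real where
  single:
    "bridge (fst X) (fst Y) (E :: 'u cstar) \<pi> \<rho> w \<Longrightarrow>
     bridge_chain C D X Y (bridge_length X Y E \<pi> \<rho> w)"
| step:
    "\<lbrakk>bridge (fst X) (fst Z) (E :: 'u cstar) \<pi> \<rho> w;
      quantum_compact_metric_space C D (fst Z) (snd Z);
      bridge_chain C D Z Y l\<rbrakk> \<Longrightarrow>
     bridge_chain C D X Y (bridge_length X Z E \<pi> \<rho> w + l)"

definition propinquity :: "real \<Rightarrow> real \<Rightarrow> 'u lip_space \<Rightarrow> 'u lip_space \<Rightarrow> ennreal" where
  "propinquity C D X Y = Inf {l. bridge_chain C D X Y l}"


section \<open>Closed quotient-norm Lip-norms\<close>

definition quotient_norm :: "'a cstar \<Rightarrow> 'a set \<Rightarrow> 'a \<Rightarrow> real" where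
  "quotient_norm A S a = (INF b\<in>S. cnorm A (a \<ominus>\<^bsub>A\<^esub> b))"

definition lip_quot ::
  "'a cstar \<Rightarrow> (nat \<Rightarrow> 'a set) \<Rightarrow> (nat \<Rightarrow> real) \<Rightarrow> 'a \<Rightarrow> ennreal" where
  "lip_quot A U \<beta> a = (SUP n. ennreal (quotient_norm A (U n) a / \<beta> n))"

definition lip_closed ::
  "'a cstar \<Rightarrow> (nat \<Rightarrow> 'a set) \<Rightarrow> (nat \<Rightarrow> real) \<Rightarrow> 'a \<Rightarrow> ennreal" where
  "lip_closed A U \<beta> a =
     (INF r\<in>{r. r > 0 \<and> complex_of_real (1 / r) \<odot>\<^bsub>A\<^esub> a \<in>
        norm_topology A closure_of {x \<in> sa A. x \<in> (\<Union>n. U n) \<and> lip_quot A U \<beta> x \<le> 1}}.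
      ennreal r)"

definition af_sequence :: "'a cstar \<Rightarrow> (nat \<Rightarrow> 'a set) \<Rightarrow> bool" where
  "af_sequence A U \<longleftrightarrow>
     incseq U \<and>
     (\<forall>n. unital_cstar_subalgebra (U n) A \<and> finite_dimensional (A\<lparr>carrier := U n\<rparr>)) \<and>
     norm_topology A closure_of (\<Union>n. U n) = carrier A \<and>
     U 0 = {c \<odot>\<^bsub>A\<^esub> \<one>\<^bsub>A\<^esub> | c. True}"

end

theory Submission
  imports Defs "Jordan_Normal_Form.Spectral_Radius"
begin

text \<open>
  A unital *-homomorphism on a finite dimensional C*-algebra is contractive: the left
  multiplication matrix of a self-adjoint h with norm below 1 has spectral radius below 1, so the
  images of the powers of h stay bounded, which the C*-identity forbids when the image of h has
  norm above 1. Hence \<open>\<phi>\<close> is isometric on each subalgebra, and the extension of its restriction to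
  their union is an isometric *-isomorphism carrying one filtration to the other, so it
  preserves the Lip-norms. The bridge with pivot 1 along this isomorphism has length zero. It is a
  bridge only because AF algebras have states; these are limits of normalised traces of left
  multiplication on the finite dimensional subalgebras.
\<close>

section \<open>Norms and subalgebras\<close>

text \<open>That an injective *-homomorphism is isometric on all of \<open>A\<close> is a fact of
  general spectral theory. The matrix argument used in its place needs a finite basis, so norm
  bounds for \<open>\<phi>\<close> are obtained only on the union of the \<open>U n\<close>; this is
  why a map \<open>\<pi>\<close> is built by extension instead of using \<open>\<phi>\<close>
  itself. Contractivity gives only one inequality. Since \<open>\<phi>\<close> maps
  \<open>U n\<close> onto \<open>V n\<close>, the inverse of each restriction is again a
  *-homomorphism on a finite dimensional algebra, which gives the other inequality, and density of
  the union of the \<open>V n\<close> makes the extension surjective. The traces on successive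
  subalgebras need not restrict to one another, so they do not glue to a functional on the union. A
  cluster point in a compact product of discs is taken instead; it inherits linearity and positivity
  because every trace is bounded by the norm, so that approximation errors vanish in the
  limit.\<close>

lemma complex_ring_simps [simp]:
  "carrier complex_ring = UNIV" "monoid.mult complex_ring = (*)" "one complex_ring = 1"
  "zero complex_ring = 0" "add complex_ring = (+)"
  by (auto simp: complex_ring_def)

context cstar_algebra begin

lemma smult_carrier [simp, intro]: "x \<in> carrier A \<Longrightarrow> c \<odot> x \<in> carrier A"
  by (rule smult_closed) auto

lemma smult_add_left: "x \<in> carrier A \<Longrightarrow> (a + b) \<odot> x = a \<odot> x \<oplus> b \<odot> x"
  using smult_l_distr[of a b x] by simp

lemma smult_smult: "x \<in> carrier A \<Longrightarrow> a \<odot> (b \<odot> x) = (a * b) \<odot> x"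
  using smult_assoc1[of a b x] by simp

lemma smult_add_right:
  "x \<in> carrier A \<Longrightarrow> y \<in> carrier A \<Longrightarrow> c \<odot> (x \<oplus> y) = c \<odot> x \<oplus> c \<odot> y"
  using smult_r_distr[of c x y] by simp

lemma smult_1 [simp]: "x \<in> carrier A \<Longrightarrow> 1 \<odot> x = x"
  using smult_one[of x] by simp

lemma smult_0 [simp]: "x \<in> carrier A \<Longrightarrow> 0 \<odot> x = \<zero>"
  using smult_l_null[of x] by simp

lemma smult_zero [simp]: "c \<odot> \<zero> = \<zero>"
  using smult_r_null[of c] by simp

lemma uminus_eq_smult: "x \<in> carrier A \<Longrightarrow> \<ominus> x = (- 1) \<odot> x"
proof -
  assume x: "x \<in> carrier A"
  have "(- 1) \<odot> x \<oplus> x = \<zero>"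
    using smult_add_left[OF x, of "- 1" 1] x by simp
  then show ?thesis using x by (metis minus_equality smult_carrier)
qed

lemma minus_eq_smult: "x \<in> carrier A \<Longrightarrow> y \<in> carrier A \<Longrightarrow> x \<ominus> y = x \<oplus> (- 1) \<odot> y"
  by (simp add: a_minus_def uminus_eq_smult)

lemma minus_self [simp]: "x \<in> carrier A \<Longrightarrow> x \<ominus> x = \<zero>"
  by (simp add: a_minus_def r_neg)

lemmas cnorm_zero_iff [simp] = cnorm_eq_zero

lemma cnorm_zero [simp]: "cnorm A \<zero> = 0" by simp

lemma cnorm_minus: "x \<in> carrier A \<Longrightarrow> cnorm A (\<ominus> x) = cnorm A x"
  by (simp add: uminus_eq_smult cnorm_smult)

text \<open>Nonnegativity is not an axiom: the triangle inequality for
  \<open>x \<oplus> \<ominus> x\<close> gives 0 on the left and twice the norm on the right.\<close>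

lemma cnorm_nonneg [simp]: "x \<in> carrier A \<Longrightarrow> 0 \<le> cnorm A x"
  using cnorm_triangle[of x "\<ominus> x"] cnorm_minus[of x] by (simp add: r_neg)

lemma minus_minus_swap:
  "x \<in> carrier A \<Longrightarrow> y \<in> carrier A \<Longrightarrow> \<ominus> (x \<ominus> y) = y \<ominus> x"
  by (simp add: a_minus_def minus_add a_comm)

lemma cnorm_minus_commute:
  "x \<in> carrier A \<Longrightarrow> y \<in> carrier A \<Longrightarrow> cnorm A (x \<ominus> y) = cnorm A (y \<ominus> x)"
  using cnorm_minus[of "x \<ominus> y"] minus_minus_swap[of x y] by simp

lemma minus_trans:
  "\<lbrakk>x \<in> carrier A; y \<in> carrier A; z \<in> carrier A\<rbrakk> \<Longrightarrow> (x \<ominus> y) \<oplus> (y \<ominus> z) = x \<ominus> z"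
  by (simp add: a_minus_def a_assoc r_neg1)

lemma cnorm_minus_triangle:
  "\<lbrakk>x \<in> carrier A; y \<in> carrier A; z \<in> carrier A\<rbrakk> \<Longrightarrow>
    cnorm A (x \<ominus> z) \<le> cnorm A (x \<ominus> y) + cnorm A (y \<ominus> z)"
  using cnorm_triangle[of "x \<ominus> y" "y \<ominus> z"] minus_trans[of x y z] by simp

lemma cnorm_diff_le:
  "x \<in> carrier A \<Longrightarrow> y \<in> carrier A \<Longrightarrow> cnorm A x \<le> cnorm A y + cnorm A (x \<ominus> y)"
  using cnorm_minus_triangle[of x y \<zero>] by (simp add: a_minus_def)

lemma Metric_space_cdist: "Metric_space (carrier A) (cdist A)"
  by unfold_locales
     (auto simp: cdist_def cnorm_minus_commute r_right_minus_eq cnorm_minus_triangle)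

lemma in_closure_iff:
  assumes "S \<subseteq> carrier A"
  shows "x \<in> norm_topology A closure_of S \<longleftrightarrow>
    x \<in> carrier A \<and> (\<forall>e>0. \<exists>y\<in>S. cnorm A (x \<ominus> y) < e)"
proof -
  interpret Metric_space "carrier A" "cdist A" by (rule Metric_space_cdist)
  show ?thesis using assms
    unfolding metric_closure_of by (auto simp: cdist_def subset_iff)
qed

lemma star_one [simp]: "star A \<one> = \<one>"
proof -
  have "star A (star A \<one> \<otimes> \<one>) = star A \<one> \<otimes> star A (star A \<one>)"
    by (rule star_mult) (auto simp: star_closed)
  then show ?thesis by (simp add: star_star star_closed)
qed

text \<open>The C*-identity and submultiplicativity bound the squared norm of \<open>y\<close> by
  the product of the norms of \<open>star A y\<close> and \<open>y\<close>. Cancel one factor, then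
  apply the result to both \<open>x\<close> and \<open>star A x\<close>.\<close>

lemma cnorm_star [simp]: "x \<in> carrier A \<Longrightarrow> cnorm A (star A x) = cnorm A x"
proof -
  have le: "cnorm A y \<le> cnorm A (star A y)" if y: "y \<in> carrier A" for y
  proof (cases "cnorm A y = 0")
    case False
    then have "0 < cnorm A y" using y by (metis cnorm_nonneg less_eq_real_def)
    moreover have "cnorm A y * cnorm A y \<le> cnorm A (star A y) * cnorm A y"
      using cnorm_mult[of "star A y" y] cstar_identity[OF y] y
      by (simp add: star_closed power2_eq_square)
    ultimately show ?thesis by simp
  qed (simp add: y star_closed)
  assume x: "x \<in> carrier A"
  show ?thesis using le[OF x] le[of "star A x"] x by (simp add: star_closed star_star)
qed

text \<open>For a self-adjoint element the C*-identity computes the norm of a square exactly, and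
  squaring doubles the exponent. Exponents that are powers of two suffice to force unbounded growth
  when the norm exceeds 1.\<close>

lemma cnorm_sa_power:
  assumes "h \<in> sa A"
  shows "h [^] (k::nat) \<in> sa A" "cnorm A (h [^] ((2::nat) ^ j)) = cnorm A h ^ (2 ^ j)"
proof -
  have h: "h \<in> carrier A" "star A h = h" using assms by (auto simp: sa_def)
  have sa: "h [^] k \<in> sa A" for k :: nat
  proof (induction k)
    case (Suc k)
    then have "star A (h [^] Suc k) = h \<otimes> h [^] k"
      using h by (simp add: sa_def star_mult)
    then show ?case using h by (simp add: sa_def nat_pow_Suc2 nat_pow_comm)
       (metis h(1) nat_pow_Suc nat_pow_Suc2)
  qed (auto simp: sa_def)
  then show "h [^] k \<in> sa A" .
  show "cnorm A (h [^] ((2::nat) ^ j)) = cnorm A h ^ (2 ^ j)"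
  proof (induction j)
    case (Suc j)
    have "h [^] (2 ^ j :: nat) \<in> sa A" by (rule sa)
    then have "cnorm A (h [^] (2 ^ j :: nat) \<otimes> h [^] (2 ^ j :: nat)) = (cnorm A (h [^] (2 ^ j :: nat)))\<^sup>2"
      using cstar_identity[of "h [^] (2 ^ j :: nat)"] by (simp add: sa_def)
    then show ?case using Suc h
      by (simp add: nat_pow_mult power_mult [symmetric] mult.commute flip: mult_2)
  qed (simp add: h)
qed

section \<open>Unital C*-subalgebras as C*-algebras in their own right\<close>

lemma subalgebra_closed:
  assumes "unital_cstar_subalgebra S A"
  shows "S \<subseteq> carrier A" "\<one> \<in> S" "\<zero> \<in> S"
    and "x \<in> S \<Longrightarrow> y \<in> S \<Longrightarrow> x \<oplus> y \<in> S" "x \<in> S \<Longrightarrow> y \<in> S \<Longrightarrow> x \<otimes> y \<in> S"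
    and "x \<in> S \<Longrightarrow> c \<odot> x \<in> S" "x \<in> S \<Longrightarrow> star A x \<in> S"
    and "x \<in> S \<Longrightarrow> \<ominus> x \<in> S" "x \<in> S \<Longrightarrow> y \<in> S \<Longrightarrow> x \<ominus> y \<in> S"
proof -
  have sr: "subring S A" and sm: "Module.submodule S complex_ring A" and st: "star A ` S \<subseteq> S"
    using assms by (auto simp: unital_cstar_subalgebra_def)
  show "S \<subseteq> carrier A" "\<one> \<in> S" "\<zero> \<in> S" 
    "x \<in> S \<Longrightarrow> y \<in> S \<Longrightarrow> x \<oplus> y \<in> S" "x \<in> S \<Longrightarrow> y \<in> S \<Longrightarrow> x \<otimes> y \<in> S"
    "x \<in> S \<Longrightarrow> \<ominus> x \<in> S"
    using subringE[OF sr] by auto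
  show "x \<in> S \<Longrightarrow> y \<in> S \<Longrightarrow> x \<ominus> y \<in> S"
    using subringE[OF sr] by (auto simp: a_minus_def)
  show "x \<in> S \<Longrightarrow> c \<odot> x \<in> S" using Module.submodule.smult_closed[OF sm, of c x] by simp
  show "x \<in> S \<Longrightarrow> star A x \<in> S" using st by auto
qed

text \<open>Subtraction in the restricted record is formed with its own additive inverse, which
  depends on the carrier. Uniqueness of inverses identifies the two, so that distances can be
  compared.\<close>

lemma subalgebra_minus:
  assumes S: "unital_cstar_subalgebra S A" and x: "x \<in> S" "y \<in> S"
  shows "x \<ominus>\<^bsub>A\<lparr>carrier := S\<rparr>\<^esub> y = x \<ominus> y"
proof -
  have "subring S A" using S by (simp add: unital_cstar_subalgebra_def)
  then interpret SR: ring "A\<lparr>carrier := S\<rparr>" by (rule subring_is_ring)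
  note sub = subalgebra_closed[OF S]
  have "\<ominus>\<^bsub>A\<lparr>carrier := S\<rparr>\<^esub> y = \<ominus> y"
    by (rule SR.minus_equality) (use sub x in \<open>auto simp: l_neg subset_iff\<close>)
  then show ?thesis by (simp add: a_minus_def)
qed

lemma cstar_algebra_subalgebra:
  assumes S: "unital_cstar_subalgebra S A"
  shows "cstar_algebra (A\<lparr>carrier := S\<rparr>)"
proof -
  note sub = subalgebra_closed[OF S]
  have inA: "x \<in> S \<Longrightarrow> x \<in> carrier A" for x using sub(1) by auto
  interpret SR: ring "A\<lparr>carrier := S\<rparr>"
    by (rule subring_is_ring) (use S in \<open>simp add: unital_cstar_subalgebra_def\<close>)
  interpret SM: module complex_ring "A\<lparr>carrier := S\<rparr>"
    by (rule Module.submodule.submodule_is_module[OF _ module_axioms])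
       (use S in \<open>simp add: unital_cstar_subalgebra_def\<close>)
  interpret MA: Metric_space "carrier A" "cdist A" by (rule Metric_space_cdist)
  \<comment> \<open>\<open>cdist\<close> is cut off outside the carrier, so the two distances are
    compared only on \<open>S\<close>. Completeness then comes from closedness of \<open>S\<close>
    in \<open>A\<close>.\<close>
  have d: "cdist (A\<lparr>carrier := S\<rparr>) x y = cdist A x y" if "x \<in> S" "y \<in> S" for x y
    using that inA by (simp add: cdist_def subalgebra_minus[OF S])
  interpret MS: Metric_space S "cdist (A\<lparr>carrier := S\<rparr>)"
  proof
    fix x y z
    show "0 \<le> cdist (A\<lparr>carrier := S\<rparr>) x y"
      by (cases "x \<in> S \<and> y \<in> S") (auto simp: d, simp_all add: cdist_def)
    show "cdist (A\<lparr>carrier := S\<rparr>) x y = cdist (A\<lparr>carrier := S\<rparr>) y x"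
      by (cases "x \<in> S \<and> y \<in> S") (auto simp: d MA.commute, simp_all add: cdist_def)
    show "x \<in> S \<Longrightarrow> y \<in> S \<Longrightarrow> cdist (A\<lparr>carrier := S\<rparr>) x y = 0 \<longleftrightarrow> x = y"
      by (simp add: d inA)
    show "x \<in> S \<Longrightarrow> y \<in> S \<Longrightarrow> z \<in> S \<Longrightarrow> cdist (A\<lparr>carrier := S\<rparr>) x z \<le>
       cdist (A\<lparr>carrier := S\<rparr>) x y + cdist (A\<lparr>carrier := S\<rparr>) y z"
      by (simp add: d inA MA.triangle)
  qed
  have comp: "MS.mcomplete"
    unfolding MS.mcomplete_def
  proof (intro allI impI)
    fix \<sigma> assume \<sigma>: "MS.MCauchy \<sigma>"
    then have rS: "range \<sigma> \<subseteq> S" by (simp add: MS.MCauchy_def)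
    then have S': "\<sigma> n \<in> S" for n by auto
    have "MA.MCauchy \<sigma>"
      using \<sigma> inA S' by (simp add: MS.MCauchy_def MA.MCauchy_def d) blast
    then obtain x where x: "limitin MA.mtopology \<sigma> x sequentially"
      using complete unfolding MA.mcomplete_def by blast
    have "closedin MA.mtopology S" using S by (simp add: unital_cstar_subalgebra_def)
    then have xS: "x \<in> S"
      using limitin_closedin[OF x, of S] S' by simp
    have "limitin MS.mtopology \<sigma> x sequentially"
      using x xS S' by (fastforce simp: MS.limit_metric_sequentially MA.limit_metric_sequentially d)
    then show "\<exists>x. limitin MS.mtopology \<sigma> x sequentially" ..
  qed
  show ?thesis
    apply (unfold_locales)
    apply (auto simp: inA one_neq_zero smult_mult_left smult_mult_right sub star_star star_add star_smult
       star_mult cnorm_triangle cnorm_smult cnorm_mult cstar_identity)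
    using comp by simp
qed

end

section \<open>Finite dimensional C*-algebras\<close>

definition mtrace :: "complex mat \<Rightarrow> complex" where
  "mtrace M = (\<Sum>i<dim_row M. M $$ (i, i))"

lemma mtrace_comm:
  assumes "M \<in> carrier_mat n n" "N \<in> carrier_mat n n"
  shows "mtrace (M * N) = mtrace (N * M)"
proof -
  have "mtrace (M * N) = (\<Sum>i<n. \<Sum>j<n. M $$ (i, j) * N $$ (j, i))"
    using assms by (auto simp: mtrace_def scalar_prod_def lessThan_atLeast0 intro!: sum.cong)
  also have "\<dots> = (\<Sum>j<n. \<Sum>i<n. M $$ (i, j) * N $$ (j, i))" by (rule sum.swap)
  also have "\<dots> = mtrace (N * M)"
    using assms by (auto simp: mtrace_def scalar_prod_def lessThan_atLeast0 mult.commute intro!: sum.cong)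
  finally show ?thesis .
qed

lemma mtrace_similar:
  assumes "similar_mat M N" "M \<in> carrier_mat n n"
  shows "mtrace M = mtrace N"
proof -
  obtain P Q where PQ: "similar_mat_wit M N P Q" using assms(1) by (auto simp: similar_mat_def)
  note D = similar_mat_witD2[OF assms(2) PQ]
  have "mtrace M = mtrace (P * (N * Q))" using D by (simp add: assoc_mult_mat[of P n n N n Q n])
  also have "\<dots> = mtrace (N * Q * P)" using D by (intro mtrace_comm) auto
  also have "N * Q * P = N" using D by (simp add: assoc_mult_mat[of N n n Q n P n])
  finally show ?thesis .
qed

text \<open>Schur triangularisation: the list is the diagonal of a triangular matrix similar to
  \<open>M\<close>. A single list serves both power sums, because squaring a triangular matrix
  squares its diagonal.\<close>

lemma mtrace_eigenvalues:
  fixes M :: "complex mat"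
  assumes M: "M \<in> carrier_mat n n"
  obtains es where "length es = n" "\<And>e. e \<in> set es \<Longrightarrow> eigenvalue M e"
    "mtrace M = sum_list es" "mtrace (M * M) = sum_list (map (\<lambda>e. e\<^sup>2) es)"
proof -
  obtain as where as: "char_poly M = (\<Prod>a\<leftarrow>as. [:- a, 1:])"
    using char_poly_factorized[OF M] by auto
  obtain B where B: "B \<in> carrier_mat n n" "upper_triangular B" "similar_mat M B"
    using schur_decomposition_exists[OF M as] by auto
  have ev: "eigenvalue M e" if "e \<in> set (diag_mat B)" for e
  proof -
    have "char_poly M = (\<Prod>a\<leftarrow>diag_mat B. [:- a, 1:])"
      using char_poly_similar[OF B(3)] char_poly_upper_triangular[OF B(1,2)] by simp
    then show ?thesis using that
      by (auto simp: eigenvalue_root_char_poly[OF M] poly_prod_list prod_list_zero_iff image_iff o_def)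
  qed
  have tri: "(B * B) $$ (i, i) = (B $$ (i, i))\<^sup>2" if i: "i < n" for i
  proof -
    have "(B * B) $$ (i, i) = (\<Sum>j<n. B $$ (i, j) * B $$ (j, i))"
      using B(1) i by (auto simp: scalar_prod_def lessThan_atLeast0 intro!: sum.cong)
    \<comment> \<open>By triangularity the first factor vanishes for \<open>j < i\<close> and the
      second for \<open>j > i\<close>.\<close>
    also have "\<dots> = (\<Sum>j<n. if j = i then (B $$ (i, i))\<^sup>2 else 0)"
    proof (rule sum.cong[OF refl])
      fix j assume "j \<in> {..<n}"
      then show "B $$ (i, j) * B $$ (j, i) = (if j = i then (B $$ (i, i))\<^sup>2 else 0)"
        using B(1,2) i by (cases i j rule: linorder_cases) 
          (auto simp: power2_eq_square dest: upper_triangularD)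
    qed
    finally show ?thesis using i by simp
  qed
  obtain P Q where PQ: "similar_mat_wit M B P Q" using B(3) by (auto simp: similar_mat_def)
  have "similar_mat (M * M) (B * B)"
    using similar_mat_wit_pow[OF PQ, of 2] M B(1)
    by (auto simp: similar_mat_def numeral_2_eq_2)
  then have "mtrace (M * M) = mtrace (B * B)" using M by (intro mtrace_similar) auto
  also have "\<dots> = sum_list (map (\<lambda>e. e\<^sup>2) (diag_mat B))"
    using B(1) tri by (auto simp: mtrace_def diag_mat_def sum_list_sum_nth lessThan_atLeast0)
  finally have 2: "mtrace (M * M) = sum_list (map (\<lambda>e. e\<^sup>2) (diag_mat B))" .
  have 1: "mtrace M = sum_list (diag_mat B)"
    using mtrace_similar[OF B(3) M] B(1)
    by (auto simp: mtrace_def diag_mat_def sum_list_sum_nth lessThan_atLeast0)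
  show thesis
    by (rule that[of "diag_mat B"]) (use ev 1 2 B(1) in \<open>auto simp: diag_mat_def\<close>)
qed

lemma cmod_sum_list_le:
  fixes K :: real
  shows "(\<And>e. e \<in> set es \<Longrightarrow> cmod e \<le> K) \<Longrightarrow> cmod (sum_list es) \<le> real (length es) * K"
proof (induction es)
  case (Cons e es)
  then have "cmod (e + sum_list es) \<le> K + real (length es) * K"
    by (intro norm_triangle_mono) auto
  then show ?case by (simp add: algebra_simps)
qed simp

section \<open>Finite linear combinations and bases\<close>

context cstar_algebra begin

text \<open>Indexing by an initial segment of the naturals allows induction on the length and
  matches the indices of matrices.\<close>

definition combo :: "(nat \<Rightarrow> 'a) \<Rightarrow> nat \<Rightarrow> (nat \<Rightarrow> complex) \<Rightarrow> 'a" where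
  "combo b n c = (\<Oplus>i\<in>{..<n}. c i \<odot> b i)"

lemma combo_0 [simp]: "combo b 0 c = \<zero>"
  by (simp add: combo_def)

lemma combo_closed [simp]: "(\<And>i. i < n \<Longrightarrow> b i \<in> carrier A) \<Longrightarrow> combo b n c \<in> carrier A"
  by (auto simp: combo_def intro!: finsum_closed)

lemma combo_Suc [simp]:
  "(\<And>i. i < Suc n \<Longrightarrow> b i \<in> carrier A) \<Longrightarrow> combo b (Suc n) c = combo b n c \<oplus> c n \<odot> b n"
  by (simp add: combo_def lessThan_Suc Pi_def a_comm)

lemma combo_add:
  "(\<And>i. i < n \<Longrightarrow> b i \<in> carrier A) \<Longrightarrow>
    combo b n (\<lambda>i. c i + d i) = combo b n c \<oplus> combo b n d"
  by (induction n) (simp_all add: smult_add_left a_ac)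

lemma combo_smult:
  "(\<And>i. i < n \<Longrightarrow> b i \<in> carrier A) \<Longrightarrow> combo b n (\<lambda>i. k * c i) = k \<odot> combo b n c"
  by (induction n) (simp_all add: smult_add_right smult_smult)

lemma combo_mult:
  "x \<in> carrier A \<Longrightarrow> (\<And>i. i < n \<Longrightarrow> b i \<in> carrier A) \<Longrightarrow>
    x \<otimes> combo b n c = combo (\<lambda>i. x \<otimes> b i) n c"
  by (induction n) (simp_all add: r_distr smult_mult_right)

lemma cnorm_combo:
  "(\<And>i. i < n \<Longrightarrow> b i \<in> carrier A) \<Longrightarrow>
    cnorm A (combo b n c) \<le> (\<Sum>i<n. cmod (c i) * cnorm A (b i))"
proof (induction n)
  case (Suc n)
  then have "cnorm A (combo b (Suc n) c) \<le> cnorm A (combo b n c) + cmod (c n) * cnorm A (b n)"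
    using cnorm_triangle[of "combo b n c" "c n \<odot> b n"] by (simp add: cnorm_smult)
  then show ?case using Suc by fastforce
qed simp

lemma combo_cong: "(\<And>i. i < n \<Longrightarrow> c i = d i) \<Longrightarrow> (\<And>i. i < n \<Longrightarrow> b i \<in> carrier A) \<Longrightarrow> combo b n c = combo b n d"
  by (induction n) simp_all

end

lemma star_hom_combo:
  assumes A: "cstar_algebra A" and B: "cstar_algebra B" and p: "p \<in> star_hom A B"
    and b: "\<And>i. i < n \<Longrightarrow> b i \<in> carrier A"
  shows "p (cstar_algebra.combo A b n c) = cstar_algebra.combo B (p \<circ> b) n c"
proof -
  interpret AA: cstar_algebra A by fact
  interpret BB: cstar_algebra B by fact
  have pr: "p \<in> Ring.ring_hom A B" and ps: "\<And>c x. x \<in> carrier A \<Longrightarrow> p (c \<odot>\<^bsub>A\<^esub> x) = c \<odot>\<^bsub>B\<^esub> p x"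
    using p by (auto simp: star_hom_def)
  note h = ring_hom_closed[OF pr] ring_hom_add[OF pr]
  have "p \<zero>\<^bsub>A\<^esub> = \<zero>\<^bsub>B\<^esub>" using ps[of "\<zero>\<^bsub>A\<^esub>" 0] h(1) by simp
  then show ?thesis using b
  proof (induction n)
    case (Suc n)
    have b: "b i \<in> carrier A" if "i < Suc n" for i using Suc.prems that by blast
    have pb: "(p \<circ> b) i \<in> carrier B" if "i < Suc n" for i using b h(1) that by simp
    have "p (AA.combo b (Suc n) c) = p (AA.combo b n c) \<oplus>\<^bsub>B\<^esub> p (c n \<odot>\<^bsub>A\<^esub> b n)"
      using b by (subst AA.combo_Suc) (auto intro!: h(2))
    also have "p (AA.combo b n c) = BB.combo (p \<circ> b) n c"
      using b Suc.prems(1) by (intro Suc.IH) auto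
    finally show ?case using b pb by (subst BB.combo_Suc) (auto simp: ps)
  qed simp
qed

locale based_cstar_algebra = cstar_algebra +
  fixes n :: nat and b :: "nat \<Rightarrow> 'a"
  assumes basis_carrier [simp]: "i < n \<Longrightarrow> b i \<in> carrier A"
    and basis_span: "x \<in> carrier A \<Longrightarrow> \<exists>c. x = combo b n c"
    and basis_indep: "combo b n c = \<zero> \<Longrightarrow> i < n \<Longrightarrow> c i = 0"

text \<open>A spanning family of least length is independent: a nontrivial relation would allow one
  member to be dropped.\<close>

lemma (in cstar_algebra) finite_dimensional_basis:
  assumes "finite_dimensional A"
  obtains n b where "based_cstar_algebra A n b"
proof -
  define P where "P n = (\<exists>b. (\<forall>i<n. b i \<in> carrier A) \<and>
    (\<forall>x\<in>carrier A. \<exists>c. x = combo b n c))" for n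
  obtain F where F: "finite F" "F \<subseteq> carrier A"
    "\<forall>x\<in>carrier A. \<exists>c. x = (\<Oplus>f\<in>F. c f \<odot> f)"
    using assms by (auto simp: finite_dimensional_def)
  obtain h where h: "bij_betw h {..<card F} F"
    using ex_bij_betw_nat_finite[OF F(1)] by (auto simp: lessThan_atLeast0)
  have "P (card F)" unfolding P_def
  proof (intro exI[of _ h] conjI ballI allI impI)
    show "h i \<in> carrier A" if "i < card F" for i
      using that h F(2) by (auto simp: bij_betw_def)
    fix x assume "x \<in> carrier A"
    then obtain c where c: "x = (\<Oplus>f\<in>F. c f \<odot> f)" using F(3) by blast
    also have "\<dots> = (\<Oplus>i\<in>{..<card F}. c (h i) \<odot> h i)"
      using h F(2) finsum_reindex[of "\<lambda>f. c f \<odot> f" h "{..<card F}"]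
      by (auto simp: bij_betw_def Pi_def subset_iff)
    finally show "\<exists>c. x = combo h (card F) c"
      by (intro exI[of _ "c \<circ> h"]) (simp add: combo_def)
  qed
  then have Pn: "P (LEAST n. P n)" and min: "\<And>m. P m \<Longrightarrow> (LEAST n. P n) \<le> m"
    by (auto intro: LeastI Least_le)
  define n where "n = (LEAST n. P n)"
  obtain b where b: "\<And>i. i < n \<Longrightarrow> b i \<in> carrier A"
    and sp: "\<And>x. x \<in> carrier A \<Longrightarrow> \<exists>c. x = combo b n c"
    using Pn by (auto simp: P_def n_def)
  have indep: "c i = 0" if c: "combo b n c = \<zero>" and i: "i < n" for c i
  proof (rule ccontr)
    assume ci: "c i \<noteq> 0"
    obtain m where m: "n = Suc m" using i by (cases n) auto
    \<comment> \<open>\<open>s\<close> enumerates in order the indices below \<open>n\<close> other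
      than \<open>i\<close>.\<close>
    define s where "s j = (if j < i then j else Suc j)" for j
    have im: "s ` {..<m} = {..<n} - {i}"
    proof -
      have "j \<in> s ` {..<m}" if j: "j < n" "j \<noteq> i" for j
      proof (cases "j < i")
        case True
        then show ?thesis using i m by (intro image_eqI[of _ _ j]) (auto simp: s_def)
      next
        case False
        then show ?thesis using j m by (intro image_eqI[of _ _ "j - 1"]) (auto simp: s_def)
      qed
      then have "{..<n} - {i} \<subseteq> s ` {..<m}" by blast
      moreover have "s ` {..<m} \<subseteq> {..<n} - {i}" using i m by (auto simp: s_def)
      ultimately show ?thesis by blast
    qed
    have inj: "inj_on s {..<m}" by (auto simp: inj_on_def s_def split: if_splits)
    have "P m" unfolding P_def
    proof (intro exI[of _ "b \<circ> s"] conjI ballI allI impI)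
      show "(b \<circ> s) j \<in> carrier A" if "j < m" for j
        using that m by (auto simp: s_def intro!: b)
      fix x assume x: "x \<in> carrier A"
      then obtain d where d: "x = combo b n d" using sp by blast
      \<comment> \<open>Adding this multiple of the relation \<open>c\<close> leaves
        \<open>x\<close> unchanged and cancels the coefficient of \<open>b i\<close>.\<close>
      define k where "k = - (d i / c i)"
      have "x = combo b n (\<lambda>j. d j + k * c j)"
        using d c b x by (simp add: combo_add combo_smult)
      also have "\<dots> = (\<Oplus>j\<in>insert i ({..<n} - {i}). (d j + k * c j) \<odot> b j)"
        unfolding combo_def using i by (simp add: insert_absorb)
      also have "\<dots> = (\<Oplus>j\<in>{..<n} - {i}. (d j + k * c j) \<odot> b j)"
        using b i ci by (subst finsum_insert) (auto simp: k_def intro!: finsum_closed l_zero)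
      also have "\<dots> = (\<Oplus>j\<in>{..<m}. (d (s j) + k * c (s j)) \<odot> b (s j))"
        using b inj finsum_reindex[of "\<lambda>j. (d j + k * c j) \<odot> b j" s "{..<m}"]
        by (auto simp: im)
      finally show "\<exists>c. x = combo (b \<circ> s) m c"
        by (intro exI[of _ "\<lambda>j. d (s j) + k * c (s j)"]) (simp add: combo_def)
    qed
    then show False using min[of m] m by (simp add: n_def)
  qed
  have "based_cstar_algebra A n b"
    by unfold_locales (use b sp indep in auto)
  then show thesis by (rule that)
qed

section \<open>Left multiplication matrices, their spectrum and their trace\<close>

context based_cstar_algebra begin

text \<open>Only the values at indices below \<open>n\<close> are determined; the choice leaves all
  others arbitrary, hence the side condition \<open>i < n\<close> throughout.\<close>

definition coord :: "'a \<Rightarrow> nat \<Rightarrow> complex" where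
  "coord x = (SOME c. x = combo b n c)"

lemma combo_coord: "x \<in> carrier A \<Longrightarrow> combo b n (coord x) = x"
  unfolding coord_def using someI_ex[OF basis_span] by metis

lemma coord_eqI:
  assumes "combo b n c = x" "i < n"
  shows "coord x i = c i"
proof -
  have x: "x \<in> carrier A" using assms(1) by (metis basis_carrier combo_closed)
  have "combo b n (\<lambda>i. coord x i + (- 1) * c i) = combo b n (coord x) \<oplus> combo b n (\<lambda>i. (- 1) * c i)"
    by (rule combo_add) simp
  also have "\<dots> = x \<oplus> (- 1) \<odot> x" 
    using assms(1) x combo_smult[of n b "- 1" c] by (simp only: combo_coord basis_carrier simp_thms)
  also have "\<dots> = \<zero>" using x minus_eq_smult[of x x] by simp
  finally show ?thesis using basis_indep[OF _ assms(2)] by fastforce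
qed

lemma coord_add:
  "x \<in> carrier A \<Longrightarrow> y \<in> carrier A \<Longrightarrow> i < n \<Longrightarrow> coord (x \<oplus> y) i = coord x i + coord y i"
  by (rule coord_eqI) (simp add: combo_add combo_coord)

lemma coord_smult: "x \<in> carrier A \<Longrightarrow> i < n \<Longrightarrow> coord (c \<odot> x) i = c * coord x i"
  by (rule coord_eqI) (simp add: combo_smult combo_coord)

lemma coord_basis: "j < n \<Longrightarrow> i < n \<Longrightarrow> coord (b j) i = (if i = j then 1 else 0)"
proof (rule coord_eqI)
  assume j: "j < n"
  have "combo b m (\<lambda>i. if i = j then 1 else 0) = (if j < m then b j else \<zero>)" if "m \<le> n" for m
    using that by (induction m) (auto simp: less_Suc_eq)
  then show "combo b n (\<lambda>i. if i = j then 1 else 0) = b j" using j by simp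
qed

lemma coord_combo:
  "(\<And>j. j < m \<Longrightarrow> v j \<in> carrier A) \<Longrightarrow> i < n \<Longrightarrow>
    coord (combo v m c) i = (\<Sum>j<m. c j * coord (v j) i)"
proof (induction m)
  case 0
  show ?case using coord_smult[of \<zero> i 0] 0 by simp
qed (simp add: coord_add coord_smult)

lemma coord_mult:
  assumes "x \<in> carrier A" "y \<in> carrier A" "i < n"
  shows "coord (x \<otimes> y) i = (\<Sum>j<n. coord (x \<otimes> b j) i * coord y j)"
proof -
  have "x \<otimes> y = combo (\<lambda>j. x \<otimes> b j) n (coord y)"
    using assms combo_mult[of x n b "coord y"] by (simp add: combo_coord)
  then show ?thesis using assms by (simp add: coord_combo mult.commute)
qed

text \<open>The left regular representation, written in the basis \<open>b\<close>.\<close>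

definition lmat :: "'a \<Rightarrow> complex mat" where
  "lmat x = Matrix.mat n n (\<lambda>(i, j). coord (x \<otimes> b j) i)"

lemma lmat_carrier [simp]: "lmat x \<in> carrier_mat n n"
  by (simp add: lmat_def)

lemma lmat_mult:
  assumes "x \<in> carrier A" "y \<in> carrier A"
  shows "lmat (x \<otimes> y) = lmat x * lmat y"
  using assms
  by (intro eq_matI)
     (auto simp: lmat_def scalar_prod_def m_assoc coord_mult[of x "y \<otimes> b _"] lessThan_atLeast0 intro!: sum.cong)

lemma lmat_one: "lmat \<one> = 1\<^sub>m n"
  by (intro eq_matI) (auto simp: lmat_def coord_basis)

lemma lmat_pow: "x \<in> carrier A \<Longrightarrow> lmat (x [^] (k::nat)) = lmat x ^\<^sub>m k"
  by (induction k) (simp_all add: lmat_one lmat_mult carrier_matD[OF lmat_carrier])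

lemma dimension_pos: "0 < n"
proof (rule ccontr)
  assume "\<not> 0 < n"
  then have "\<one> = \<zero>" using combo_coord[of \<one>] by simp
  then show False using one_neq_zero by simp
qed

text \<open>An eigenvector is read as the coordinate vector of an element \<open>y\<close>. The
  eigenvalue equation thereby becomes an identity in the algebra, to which the norm axioms and the
  involution apply.\<close>

lemma eigenvalue_lmat:
  assumes x: "x \<in> carrier A" and e: "eigenvalue (lmat x) e"
  obtains y where "y \<in> carrier A" "y \<noteq> \<zero>" "x \<otimes> y = e \<odot> y"
proof -
  obtain v where v: "v \<in> carrier_vec n" "v \<noteq> 0\<^sub>v n" "lmat x *\<^sub>v v = e \<cdot>\<^sub>v v"
    using e by (auto simp: eigenvalue_def eigenvector_def carrier_matD[OF lmat_carrier])
  define y where "y = combo b n (vec_index v)"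
  have y: "y \<in> carrier A" by (simp add: y_def)
  have cy: "coord y i = vec_index v i" if "i < n" for i
    by (rule coord_eqI) (auto simp: y_def that)
  have "y \<noteq> \<zero>"
  proof
    assume "y = \<zero>"
    then have "vec_index v i = 0" if "i < n" for i using basis_indep[of "vec_index v" i] that by (simp add: y_def)
    then show False using v(1,2) by (auto intro: eq_vecI)
  qed
  moreover have "x \<otimes> y = e \<odot> y"
  proof -
    have "coord (x \<otimes> y) i = coord (e \<odot> y) i" if i: "i < n" for i
    proof -
      have "coord (x \<otimes> y) i = (\<Sum>j<n. coord (x \<otimes> b j) i * vec_index v j)"
        using coord_mult[OF x y i] by (simp add: cy)
      also have "\<dots> = vec_index (lmat x *\<^sub>v v) i"
        using v(1) i by (auto simp: lmat_def scalar_prod_def lessThan_atLeast0 intro!: sum.cong)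
      also have "\<dots> = coord (e \<odot> y) i" using v(1,3) i y by (simp add: coord_smult cy)
      finally show ?thesis .
    qed
    then have "combo b n (coord (x \<otimes> y)) = combo b n (coord (e \<odot> y))" by (intro combo_cong) auto
    then show ?thesis using x y by (simp add: combo_coord)
  qed
  ultimately show thesis using y that by blast
qed

text \<open>Take norms in \<open>x \<otimes> y = e \<odot> y\<close> and cancel the norm of
  \<open>y\<close>.\<close>

lemma eigenvalue_le_cnorm:
  assumes x: "x \<in> carrier A" and e: "eigenvalue (lmat x) e"
  shows "cmod e \<le> cnorm A x"
proof -
  obtain y where y: "y \<in> carrier A" "y \<noteq> \<zero>" "x \<otimes> y = e \<odot> y"
    using eigenvalue_lmat[OF x e] .
  have "0 < cnorm A y" using y(1,2) by (metis cnorm_eq_zero cnorm_nonneg less_eq_real_def)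
  moreover have "cmod e * cnorm A y \<le> cnorm A x * cnorm A y"
    using cnorm_mult[OF x y(1)] y by (simp add: cnorm_smult)
  ultimately show ?thesis by simp
qed

text \<open>The Hilbert space argument with \<open>star A y \<otimes> y\<close> in the role of the
  inner product: evaluating \<open>star A y \<otimes> (h \<otimes> y)\<close> in two ways yields
  both \<open>e\<close> and \<open>cnj e\<close> as its coefficient, and the C*-identity keeps that
  product nonzero.\<close>

lemma eigenvalue_sa_real:
  assumes h: "h \<in> sa A" and e: "eigenvalue (lmat h) e"
  shows "e \<in> \<real>"
proof -
  have hc: "h \<in> carrier A" "star A h = h" using h by (auto simp: sa_def)
  obtain y where y: "y \<in> carrier A" "y \<noteq> \<zero>" "h \<otimes> y = e \<odot> y"
    using eigenvalue_lmat[OF hc(1) e] .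
  let ?q = "star A y \<otimes> y"
  have q: "?q \<in> carrier A" using y(1) by (simp add: star_closed)
  have "star A y \<otimes> (h \<otimes> y) = e \<odot> ?q"
    using y by (simp add: smult_mult_right star_closed)
  moreover have "star A y \<otimes> (h \<otimes> y) = star A (h \<otimes> y) \<otimes> y"
    using hc y(1) by (simp add: star_mult star_closed m_assoc)
  moreover have "star A (h \<otimes> y) \<otimes> y = cnj e \<odot> ?q"
    using y by (simp add: star_smult smult_mult_left star_closed)
  ultimately have "e \<odot> ?q = cnj e \<odot> ?q" by simp
  then have "(e - cnj e) \<odot> ?q = \<zero>"
    using q smult_add_left[of ?q e "- cnj e"] smult_add_left[of ?q "cnj e" "- cnj e"] by simp
  then have "cmod (e - cnj e) * cnorm A ?q = 0" using q by (metis cnorm_smult cnorm_zero)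
  moreover have "cnorm A ?q \<noteq> 0" using y(1,2) by (simp add: cstar_identity)
  ultimately have "cmod (e - cnj e) = 0" by (metis mult_eq_0_iff)
  then have "cnj e = e" by (metis norm_eq_zero eq_iff_diff_eq_0)
  then show ?thesis by (simp add: Reals_cnj_iff)
qed

definition trace :: "'a \<Rightarrow> complex" where
  "trace x = (\<Sum>i<n. coord (x \<otimes> b i) i)"

lemma trace_eq_mtrace: "trace x = mtrace (lmat x)"
  by (simp add: trace_def mtrace_def lmat_def)

lemma trace_add: "x \<in> carrier A \<Longrightarrow> y \<in> carrier A \<Longrightarrow> trace (x \<oplus> y) = trace x + trace y"
  by (simp add: trace_def l_distr coord_add sum.distrib)

lemma trace_smult: "x \<in> carrier A \<Longrightarrow> trace (c \<odot> x) = c * trace x"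
  by (simp add: trace_def smult_mult_left coord_smult sum_distrib_left)

lemma trace_comm: "x \<in> carrier A \<Longrightarrow> y \<in> carrier A \<Longrightarrow> trace (x \<otimes> y) = trace (y \<otimes> x)"
  by (simp add: trace_eq_mtrace lmat_mult mtrace_comm[OF lmat_carrier lmat_carrier])

lemma trace_one: "trace \<one> = of_nat n"
  by (simp add: trace_def coord_basis)

text \<open>The trace is a sum of \<open>n\<close> eigenvalues, each bounded by the norm; dividing
  by \<open>n\<close> will therefore give a functional of norm at most 1.\<close>

lemma cmod_trace_le: "x \<in> carrier A \<Longrightarrow> cmod (trace x) \<le> n * cnorm A x"
proof -
  assume x: "x \<in> carrier A"
  obtain es where es: "length es = n" "\<And>e. e \<in> set es \<Longrightarrow> eigenvalue (lmat x) e"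
    "mtrace (lmat x) = sum_list es"
    using mtrace_eigenvalues[OF lmat_carrier, of x] by metis
  then show ?thesis
    using cmod_sum_list_le[of es "cnorm A x"] eigenvalue_le_cnorm[OF x] by (simp add: trace_eq_mtrace)
qed

lemma trace_sa_square:
  assumes h: "h \<in> sa A"
  shows "trace (h \<otimes> h) \<in> \<real>\<^sub>\<ge>\<^sub>0"
proof -
  obtain es where es: "\<And>e. e \<in> set es \<Longrightarrow> eigenvalue (lmat h) e"
    "mtrace (lmat h * lmat h) = sum_list (map (\<lambda>e. e\<^sup>2) es)"
    using mtrace_eigenvalues[OF lmat_carrier, of h] by metis
  have "sum_list (map (\<lambda>e. e\<^sup>2) fs) \<in> \<real>\<^sub>\<ge>\<^sub>0" if "\<forall>e\<in>set fs. e \<in> \<real>" for fs :: "complex list"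
    using that
    by (induction fs) (auto intro!: nonneg_Reals_add_I simp: nonneg_Reals_of_real_iff
       simp flip: of_real_power elim!: Reals_cases)
  then show ?thesis
    using es eigenvalue_sa_real[OF h] h by (simp add: trace_eq_mtrace lmat_mult sa_def)
qed

text \<open>
  Since the trace is tracial, positivity of \<open>trace (x\<^sup>* x)\<close> reduces to that of squares of
  self-adjoint elements, which holds because their eigenvalues are real.
\<close>

lemma trace_positive:
  assumes x: "x \<in> carrier A"
  shows "trace (star A x \<otimes> x) \<in> \<real>\<^sub>\<ge>\<^sub>0"
proof -
  let ?s = "star A x"
  have s: "?s \<in> carrier A" using x by (rule star_closed)
  \<comment> \<open>These are, up to factors, the real and imaginary parts of \<open>x\<close>. In
    the sum of their squares the terms \<open>x \<otimes> x\<close> and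
    \<open>?s \<otimes> ?s\<close> cancel, leaving twice \<open>x \<otimes> ?s\<close> plus twice
    \<open>?s \<otimes> x\<close>; by the trace property this counts \<open>?s \<otimes> x\<close>
    four times.\<close>
  define h where "h = x \<oplus> ?s"
  define k where "k = \<i> \<odot> x \<oplus> (- \<i>) \<odot> ?s"
  have hk: "h \<in> sa A" "k \<in> sa A"
    using x s by (auto simp: h_def k_def sa_def star_add star_smult star_star a_comm)
  have "trace (h \<otimes> h) = trace (x \<otimes> x) + 2 * trace (?s \<otimes> x) + trace (?s \<otimes> ?s)"
    using x s by (simp add: h_def l_distr r_distr trace_add trace_comm[of x ?s])
  moreover have "\<i> * (\<i> * z) = - z" for z by (simp flip: mult.assoc)
  then have "trace (k \<otimes> k) = - trace (x \<otimes> x) + 2 * trace (?s \<otimes> x) - trace (?s \<otimes> ?s)"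
    using x s by (simp add: k_def l_distr r_distr trace_add trace_smult smult_mult_left
      smult_mult_right smult_smult trace_comm[of x ?s] right_diff_distrib)
  ultimately have "trace (?s \<otimes> x) = of_real (1 / 4) * (trace (h \<otimes> h) + trace (k \<otimes> k))"
    by (simp add: field_simps)
  moreover have "of_real (1 / 4) \<in> (\<real>\<^sub>\<ge>\<^sub>0 :: complex set)" by (subst nonneg_Reals_of_real_iff) simp
  ultimately show ?thesis
    using trace_sa_square[OF hk(1)] trace_sa_square[OF hk(2)]
    by (metis nonneg_Reals_add_I nonneg_Reals_mult_I)
qed

text \<open>Eigenvalues are bounded by the norm, so the spectral radius is below 1 and the matrix
  powers stay bounded. The strict inequality matters: at spectral radius 1, nontrivial Jordan blocks
  make powers grow.\<close>

lemma coord_powers_bounded: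
  assumes h: "h \<in> carrier A" and lt: "cnorm A h < 1"
  obtains K where "\<And>k i. i < n \<Longrightarrow> cmod (coord (h [^] (k::nat)) i) \<le> K"
proof -
  have "spectral_radius (lmat h) < 1"
    using spectral_radius_mem_max(1)[OF lmat_carrier dimension_pos, of h] eigenvalue_le_cnorm[OF h] lt
    by (force simp: spectrum_def)
  then obtain c where c: "\<And>k. norm_bound (lmat h ^\<^sub>m k) c"
    using spectral_radius_jnf_norm_bound_less_1_upper_triangular[OF lmat_carrier] by blast
  \<comment> \<open>A power of \<open>h\<close> is that power applied to the unit, so its
    coordinates are its matrix times the coordinates of \<open>\<one>\<close>; \<open>c\<close>
    bounds every matrix entry.\<close>
  define K where "K = (\<Sum>j<n. c * cmod (coord \<one> j))"
  have "cmod (coord (h [^] k) i) \<le> K" if i: "i < n" for i and k :: nat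
  proof -
    have hk: "h [^] k \<in> carrier A" using h by simp
    have "coord (h [^] k) i = (\<Sum>j<n. coord (h [^] k \<otimes> b j) i * coord \<one> j)"
      using coord_mult[OF hk one_closed i] hk by simp
    also have "cmod \<dots> \<le> (\<Sum>j<n. cmod (coord (h [^] k \<otimes> b j) i) * cmod (coord \<one> j))"
      using norm_sum[of "\<lambda>j. coord (h [^] k \<otimes> b j) i * coord \<one> j" "{..<n}"] by (simp add: norm_mult)
    also have "\<dots> \<le> K"
      unfolding K_def
    proof (intro sum_mono mult_right_mono)
      fix j assume j: "j \<in> {..<n}"
      have "cmod (lmat (h [^] k) $$ (i, j)) \<le> c"
        using c[of k] i j h by (simp add: norm_bound_def lmat_pow carrier_matD[OF lmat_carrier])
      then show "cmod (coord (h [^] k \<otimes> b j) i) \<le> c" using i j by (simp add: lmat_def)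
    qed simp
    finally show ?thesis .
  qed
  then show thesis by (rule that)
qed

end

section \<open>Contractivity of *-homomorphisms and existence of states in finite dimension\<close>

text \<open>The finite basis enters twice: it bounds the coordinates of the powers, and it turns
  this into a norm bound in \<open>B\<close>, because the image of each power is a combination of
  the finitely many \<open>p (b i)\<close>. Continuity of \<open>p\<close> is thus a
  consequence.\<close>

lemma star_hom_contractive:
  assumes A: "cstar_algebra A" and fin: "finite_dimensional A" and B: "cstar_algebra B"
    and p: "p \<in> star_hom A B" and x: "x \<in> carrier A"
  shows "cnorm B (p x) \<le> cnorm A x"
proof -
  interpret AA: cstar_algebra A by fact
  interpret BB: cstar_algebra B by fact
  obtain n b where "based_cstar_algebra A n b" using AA.finite_dimensional_basis[OF fin] .
  then interpret BA: based_cstar_algebra A n b .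
  have pr: "p \<in> Ring.ring_hom A B" and ps: "\<And>c x. x \<in> carrier A \<Longrightarrow> p (c \<odot>\<^bsub>A\<^esub> x) = c \<odot>\<^bsub>B\<^esub> p x"
    and pst: "\<And>x. x \<in> carrier A \<Longrightarrow> p (star A x) = star B (p x)"
    using p by (auto simp: star_hom_def)
  note pc = ring_hom_closed[OF pr]
  have pow: "p (x [^]\<^bsub>A\<^esub> (k::nat)) = p x [^]\<^bsub>B\<^esub> k" if "x \<in> carrier A" for x k
    using that by (induction k) (simp_all add: ring_hom_one[OF pr] ring_hom_mult[OF pr])
  have small: "cnorm B (p g) \<le> 1" if g: "g \<in> sa A" and lt: "cnorm A g < 1" for g
  proof (rule ccontr)
    assume "\<not> cnorm B (p g) \<le> 1"
    then have gt: "1 < cnorm B (p g)" by simp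
    have gc: "g \<in> carrier A" using g by (simp add: sa_def)
    have pg: "p g \<in> sa B" using g pst[of g] pc by (simp add: sa_def)
    obtain K where K: "\<And>k i. i < n \<Longrightarrow> cmod (BA.coord (g [^]\<^bsub>A\<^esub> (k::nat)) i) \<le> K"
      using BA.coord_powers_bounded[OF gc lt] by blast
    define M where "M = (\<Sum>i<n. K * cnorm B (p (b i)))"
    have bound: "cnorm B (p g [^]\<^bsub>B\<^esub> k) \<le> M" for k :: nat
    proof -
      let ?c = "BA.coord (g [^]\<^bsub>A\<^esub> k)"
      have "p g [^]\<^bsub>B\<^esub> k = p (AA.combo b n ?c)" using gc by (simp add: pow BA.combo_coord)
      also have "\<dots> = BB.combo (p \<circ> b) n ?c" by (rule star_hom_combo[OF A B p]) simp
      finally have "cnorm B (p g [^]\<^bsub>B\<^esub> k) \<le> (\<Sum>i<n. cmod (?c i) * cnorm B (p (b i)))"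
        using BB.cnorm_combo[of n "p \<circ> b" ?c] pc by simp
      also have "\<dots> \<le> M" unfolding M_def
        by (intro sum_mono mult_right_mono) (auto simp: K pc)
      finally show ?thesis .
    qed
    \<comment> \<open>This \<open>m\<close> plays two roles: the power with exponent
      \<open>m\<close> exceeds \<open>M\<close>, and since \<open>m\<close> is at most
      \<open>2 ^ m\<close> so does the power with exponent \<open>2 ^ m\<close>, whose norm is known
      exactly.\<close>
    obtain m where m: "M < cnorm B (p g) ^ m" using real_arch_pow[OF gt] by blast
    have "cnorm B (p g) ^ m \<le> cnorm B (p g) ^ (2 ^ m)"
      using gt by (intro power_increasing) (auto simp: less_imp_le)
    also have "\<dots> = cnorm B (p g [^]\<^bsub>B\<^esub> ((2::nat) ^ m))" using BB.cnorm_sa_power(2)[OF pg] by simp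
    also have "\<dots> \<le> M" by (rule bound)
    finally show False using m by simp
  qed
  \<comment> \<open>The bound is so far known for self-adjoint elements only; the C*-identity
    transfers it to arbitrary \<open>x\<close> through this one.\<close>
  let ?h = "star A x \<otimes>\<^bsub>A\<^esub> x"
  have hc: "?h \<in> carrier A" and h: "?h \<in> sa A"
    using x by (auto simp: sa_def AA.star_closed AA.star_mult AA.star_star)
  have nh: "cnorm A ?h = (cnorm A x)\<^sup>2" using x by (rule AA.cstar_identity)
  have "p ?h = star B (p x) \<otimes>\<^bsub>B\<^esub> p x" using x by (simp add: ring_hom_mult[OF pr] AA.star_closed pst)
  then have ph: "cnorm B (p ?h) = (cnorm B (p x))\<^sup>2" using x pc by (simp add: BB.cstar_identity)
  \<comment> \<open>A free scaling factor meets the strict bound in \<open>small\<close> and avoids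
    dividing by a norm that may be zero.\<close>
  have "t * (cnorm B (p x))\<^sup>2 \<le> 1" if t: "0 < t" "t * (cnorm A x)\<^sup>2 < 1" for t
  proof -
    have "of_real t \<odot>\<^bsub>A\<^esub> ?h \<in> sa A" using h hc by (simp add: sa_def AA.star_smult)
    moreover have "cnorm A (of_real t \<odot>\<^bsub>A\<^esub> ?h) < 1" using hc t nh by (simp add: AA.cnorm_smult)
    ultimately have "cnorm B (p (of_real t \<odot>\<^bsub>A\<^esub> ?h)) \<le> 1" by (rule small)
    then show ?thesis using hc t ph pc by (simp add: ps BB.cnorm_smult)
  qed
  note key = this
  have "(cnorm B (p x))\<^sup>2 \<le> (cnorm A x)\<^sup>2"
  proof (rule ccontr)
    assume "\<not> (cnorm B (p x))\<^sup>2 \<le> (cnorm A x)\<^sup>2"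
    \<comment> \<open>With \<open>t = 1 / s\<close> the scaled element has norm below 1 while its
      image has norm above 1.\<close>
    then obtain s where s: "(cnorm A x)\<^sup>2 < s" "s < (cnorm B (p x))\<^sup>2" by (meson dense not_le)
    then have "0 < s" by (meson le_less_trans zero_le_power2)
    then show False using key[of "1 / s"] s by (simp add: field_simps)
  qed
  then show ?thesis by (rule power2_le_imp_le[OF _ AA.cnorm_nonneg[OF x]])
qed

lemma finite_dimensional_state:
  assumes "cstar_algebra A" "finite_dimensional A"
  obtains \<tau> where "\<tau> \<in> states A" "\<And>x. x \<in> carrier A \<Longrightarrow> cmod (\<tau> x) \<le> cnorm A x"
proof -
  interpret AA: cstar_algebra A by fact
  obtain n b where "based_cstar_algebra A n b" using AA.finite_dimensional_basis[OF assms(2)] .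
  then interpret BA: based_cstar_algebra A n b .
  have n: "0 < n" by (rule BA.dimension_pos)
  \<comment> \<open>Division by the dimension gives the unit the value 1; \<open>restrict\<close> is
    there because \<open>states\<close> requires extensional functions.\<close>
  define \<tau> where "\<tau> = restrict (\<lambda>x. of_real (1 / n) * BA.trace x) (carrier A)"
  have "\<tau> \<in> states A"
    unfolding states_def
  proof (intro CollectI conjI ballI allI)
    fix x assume "x \<in> carrier A"
    have "complex_of_real (1 / n) \<in> \<real>\<^sub>\<ge>\<^sub>0" by (subst nonneg_Reals_of_real_iff) simp
    then show "\<tau> (star A x \<otimes>\<^bsub>A\<^esub> x) \<in> \<real>\<^sub>\<ge>\<^sub>0"
      unfolding \<tau>_def using BA.trace_positive[OF \<open>x \<in> carrier A\<close>] \<open>x \<in> carrier A\<close>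
      by (simp add: AA.star_closed nonneg_Reals_mult_I del: of_real_divide)
  qed (auto simp: \<tau>_def BA.trace_add BA.trace_smult BA.trace_one n field_simps)
  moreover have "cmod (\<tau> x) \<le> cnorm A x" if "x \<in> carrier A" for x
    using BA.cmod_trace_le[OF that] n that by (simp add: \<tau>_def norm_divide field_simps)
  ultimately show thesis by (rule that)
qed

section \<open>States of AF algebras\<close>

context cstar_algebra begin

lemma minus_add_minus:
  "\<lbrakk>x \<in> carrier A; y \<in> carrier A; p \<in> carrier A; q \<in> carrier A\<rbrakk> \<Longrightarrow>
    (x \<oplus> y) \<ominus> (p \<oplus> q) = (x \<ominus> p) \<oplus> (y \<ominus> q)"
  by (simp add: a_minus_def minus_add a_ac)

lemma cnorm_add_diff_le:
  "\<lbrakk>x \<in> carrier A; y \<in> carrier A; p \<in> carrier A; q \<in> carrier A\<rbrakk> \<Longrightarrow>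
    cnorm A ((x \<oplus> y) \<ominus> (p \<oplus> q)) \<le> cnorm A (x \<ominus> p) + cnorm A (y \<ominus> q)"
  using cnorm_triangle[of "x \<ominus> p" "y \<ominus> q"] by (simp add: minus_add_minus)

lemma smult_minus:
  "\<lbrakk>x \<in> carrier A; p \<in> carrier A\<rbrakk> \<Longrightarrow> (c \<odot> x) \<ominus> (c \<odot> p) = c \<odot> (x \<ominus> p)"
  by (simp add: minus_eq_smult smult_add_right smult_smult mult.commute)

lemma cnorm_smult_diff:
  "\<lbrakk>x \<in> carrier A; p \<in> carrier A\<rbrakk> \<Longrightarrow>
    cnorm A ((c \<odot> x) \<ominus> (c \<odot> p)) = cmod c * cnorm A (x \<ominus> p)"
  by (simp add: smult_minus cnorm_smult)

lemma star_minus: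
  "\<lbrakk>x \<in> carrier A; p \<in> carrier A\<rbrakk> \<Longrightarrow> star A (x \<ominus> p) = star A x \<ominus> star A p"
  by (simp add: minus_eq_smult star_add star_smult star_closed)

lemma cnorm_star_diff:
  "\<lbrakk>x \<in> carrier A; p \<in> carrier A\<rbrakk> \<Longrightarrow> cnorm A (star A x \<ominus> star A p) = cnorm A (x \<ominus> p)"
  using cnorm_star[of "x \<ominus> p"] by (simp add: star_minus)

text \<open>The norm of \<open>p\<close> is replaced by that of \<open>x\<close> plus an error, so
  the bound tends to 0 when \<open>p\<close> and \<open>q\<close> approach \<open>x\<close> and
  \<open>y\<close>, without a separate bound on \<open>p\<close>.\<close>

lemma cnorm_mult_diff_le:
  assumes "x \<in> carrier A" "y \<in> carrier A" "p \<in> carrier A" "q \<in> carrier A"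
  shows "cnorm A ((x \<otimes> y) \<ominus> (p \<otimes> q)) \<le>
    cnorm A (x \<ominus> p) * cnorm A y + (cnorm A x + cnorm A (x \<ominus> p)) * cnorm A (y \<ominus> q)"
proof -
  have "(x \<otimes> y) \<ominus> (p \<otimes> q) = ((x \<otimes> y) \<ominus> (p \<otimes> y)) \<oplus> ((p \<otimes> y) \<ominus> (p \<otimes> q))"
    using assms by (simp add: minus_trans)
  also have "\<dots> = (x \<ominus> p) \<otimes> y \<oplus> p \<otimes> (y \<ominus> q)"
    using assms by (simp add: minus_eq_smult l_distr r_distr smult_mult_left smult_mult_right)
  finally have "cnorm A ((x \<otimes> y) \<ominus> (p \<otimes> q)) \<le>
      cnorm A (x \<ominus> p) * cnorm A y + cnorm A p * cnorm A (y \<ominus> q)"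
    using cnorm_triangle[of "(x \<ominus> p) \<otimes> y" "p \<otimes> (y \<ominus> q)"] cnorm_mult[of "x \<ominus> p" y]
      cnorm_mult[of p "y \<ominus> q"] assms by simp
  moreover have "cnorm A p \<le> cnorm A x + cnorm A (x \<ominus> p)"
    using cnorm_diff_le[of p x] cnorm_minus_commute[of p x] assms by simp
  ultimately show ?thesis
    using mult_right_mono[of "cnorm A p" "cnorm A x + cnorm A (x \<ominus> p)" "cnorm A (y \<ominus> q)"] assms
    by simp
qed

text \<open>Stated through real distances, so that limit rules for real sequences apply directly;
  membership in the carrier is supplied separately.\<close>

definition nlim :: "(nat \<Rightarrow> 'a) \<Rightarrow> 'a \<Rightarrow> bool" where
  "nlim u x \<longleftrightarrow> (\<lambda>n. cnorm A (x \<ominus> u n)) \<longlonglongrightarrow> 0"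

definition ncauchy :: "(nat \<Rightarrow> 'a) \<Rightarrow> bool" where
  "ncauchy u \<longleftrightarrow> (\<forall>e>0. \<exists>N. \<forall>m\<ge>N. \<forall>n\<ge>N. cnorm A (u m \<ominus> u n) < e)"

lemma nlimI:
  assumes "\<And>n. cnorm A (x \<ominus> u n) \<le> f n" "f \<longlonglongrightarrow> 0" "x \<in> carrier A" "\<And>n. u n \<in> carrier A"
  shows "nlim u x"
  unfolding nlim_def using assms by (intro Lim_null_comparison[OF always_eventually assms(2)]) simp

lemma nlim_const: "x \<in> carrier A \<Longrightarrow> nlim (\<lambda>n. x) x"
  by (simp add: nlim_def)

context
  fixes u x
  assumes c: "x \<in> carrier A" "\<And>n. u n \<in> carrier A" and l: "nlim u x"
begin

lemma nlim_smult: "nlim (\<lambda>n. k \<odot> u n) (k \<odot> x)"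
  using tendsto_mult_right_zero[OF l[unfolded nlim_def], of "cmod k"]
  by (simp add: nlim_def cnorm_smult_diff c)

lemma nlim_star: "nlim (\<lambda>n. star A (u n)) (star A x)"
  using l by (simp add: nlim_def cnorm_star_diff c)

lemma nlim_cnorm: "(\<lambda>n. cnorm A (u n)) \<longlonglongrightarrow> cnorm A x"
proof (rule LIM_zero_cancel, rule Lim_null_comparison[OF always_eventually l[unfolded nlim_def]], rule allI)
  fix n
  show "norm (cnorm A (u n) - cnorm A x) \<le> cnorm A (x \<ominus> u n)"
    using cnorm_diff_le[of "u n" x] cnorm_diff_le[of x "u n"] cnorm_minus_commute[of x "u n"]
    by (simp add: c abs_le_iff)
qed

lemma nlim_imp_ncauchy: "ncauchy u"
  unfolding ncauchy_def
proof (intro allI impI)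
  fix e :: real assume "0 < e"
  then have "eventually (\<lambda>n. cnorm A (x \<ominus> u n) < e / 2) sequentially"
    using l unfolding nlim_def by (intro order_tendstoD(2)) auto
  then obtain N where N: "\<And>n. N \<le> n \<Longrightarrow> cnorm A (x \<ominus> u n) < e / 2"
    by (auto simp: eventually_sequentially)
  have "cnorm A (u m \<ominus> u n) < e" if "N \<le> m" "N \<le> n" for m n
    using N[OF that(1)] N[OF that(2)] cnorm_minus_triangle[of "u m" x "u n"]
      cnorm_minus_commute[of x "u m"] by (simp add: c)
  then show "\<exists>N. \<forall>m\<ge>N. \<forall>n\<ge>N. cnorm A (u m \<ominus> u n) < e" by blast
qed

end

context
  fixes u v x y
  assumes c: "x \<in> carrier A" "y \<in> carrier A" "\<And>n. u n \<in> carrier A" "\<And>n. v n \<in> carrier A"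
    and l: "nlim u x" "nlim v y"
begin

lemma nlim_add: "nlim (\<lambda>n. u n \<oplus> v n) (x \<oplus> y)"
  by (rule nlimI[OF cnorm_add_diff_le tendsto_add_zero[OF l[unfolded nlim_def]]]) (simp_all add: c)

lemma nlim_mult: "nlim (\<lambda>n. u n \<otimes> v n) (x \<otimes> y)"
proof (rule nlimI[OF cnorm_mult_diff_le])
  have "(\<lambda>n. cnorm A (x \<ominus> u n) * cnorm A y + (cnorm A x + cnorm A (x \<ominus> u n)) * cnorm A (y \<ominus> v n))
      \<longlonglongrightarrow> 0 * cnorm A y + (cnorm A x + 0) * 0"
    by (intro tendsto_intros l[unfolded nlim_def])
  then show "(\<lambda>n. cnorm A (x \<ominus> u n) * cnorm A y + (cnorm A x + cnorm A (x \<ominus> u n)) * cnorm A (y \<ominus> v n))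
      \<longlonglongrightarrow> 0" by simp
qed (simp_all add: c)

end

lemma nlim_dist:
  assumes "x \<in> carrier A" "y \<in> carrier A" "\<And>n. u n \<in> carrier A" "\<And>n. v n \<in> carrier A"
    and "nlim u x" "nlim v y"
  shows "(\<lambda>n. cnorm A (u n \<ominus> v n)) \<longlonglongrightarrow> cnorm A (x \<ominus> y)"
proof -
  have s: "nlim (\<lambda>n. (- 1) \<odot> v n) ((- 1) \<odot> y)"
    by (rule nlim_smult) (use assms in auto)
  have d: "nlim (\<lambda>n. u n \<oplus> (- 1) \<odot> v n) (x \<oplus> (- 1) \<odot> y)"
    by (rule nlim_add) (use assms s in auto)
  have "(\<lambda>n. cnorm A (u n \<oplus> (- 1) \<odot> v n)) \<longlonglongrightarrow> cnorm A (x \<oplus> (- 1) \<odot> y)"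
    by (rule nlim_cnorm[OF _ _ d]) (use assms in auto)
  then show ?thesis using assms by (simp add: minus_eq_smult)
qed

lemma ncauchy_convergent:
  assumes u: "\<And>n. u n \<in> carrier A" and c: "ncauchy u"
  obtains x where "x \<in> carrier A" "nlim u x"
proof -
  interpret MA: Metric_space "carrier A" "cdist A" by (rule Metric_space_cdist)
  have "MA.MCauchy u" using u c by (auto simp: MA.MCauchy_def cdist_def ncauchy_def)
  then obtain x where "limitin MA.mtopology u x sequentially"
    using complete unfolding MA.mcomplete_def by blast
  then have x: "x \<in> carrier A" "\<And>e. 0 < e \<Longrightarrow> \<exists>N. \<forall>n\<ge>N. cnorm A (u n \<ominus> x) < e"
    using u by (auto simp: MA.limit_metric_sequentially cdist_def)
  have "nlim u x"
    unfolding nlim_def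
  proof (rule LIMSEQ_I)
    fix e :: real assume "0 < e"
    then show "\<exists>N. \<forall>n\<ge>N. norm (cnorm A (x \<ominus> u n) - 0) < e"
      using x(2)[of e] u x(1) by (simp add: cnorm_minus_commute[of x])
  qed
  then show thesis using x(1) that by blast
qed

lemma in_closure_nlim:
  assumes "S \<subseteq> carrier A" "x \<in> norm_topology A closure_of S"
  obtains u where "\<And>n. u n \<in> S" "nlim u x"
proof -
  have x: "x \<in> carrier A" "\<And>e. 0 < e \<Longrightarrow> \<exists>y\<in>S. cnorm A (x \<ominus> y) < e"
    using assms in_closure_iff by auto
  have "\<exists>y\<in>S. cnorm A (x \<ominus> y) < 1 / Suc n" for n by (rule x(2)) simp
  then obtain u where u: "\<And>n. u n \<in> S" "\<And>n. cnorm A (x \<ominus> u n) < 1 / Suc n" by metis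
  have "nlim u x"
    by (rule nlimI[OF less_imp_le[OF u(2)] LIMSEQ_Suc[OF lim_1_over_n]]) (use u(1) assms(1) x(1) in auto)
  then show thesis using u(1) that by blast
qed

end

section \<open>Cluster points and states of AF algebras\<close>

text \<open>A cluster point in an uncountable product need not be the limit of a subsequence, so the
  argument runs on filters: along the nontrivial infimum \<open>\<Phi>\<close> tends both to
  \<open>l\<close> and to 0.\<close>

lemma tendsto_cluster_zero:
  fixes \<Phi> :: "'b \<Rightarrow> 'c::real_normed_vector"
  assumes "inf N (filtermap f sequentially) \<noteq> bot" "(\<Phi> \<longlongrightarrow> l) N"
    and "(\<lambda>n. \<Phi> (f n)) \<longlonglongrightarrow> 0"
  shows "l = 0"
proof -
  have "(\<Phi> \<longlongrightarrow> l) (inf N (filtermap f sequentially))"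
    using assms(2) by (rule tendsto_mono[rotated]) simp
  moreover have "(\<Phi> \<longlongrightarrow> 0) (filtermap f sequentially)"
    using assms(3) by (simp add: filterlim_filtermap)
  then have "(\<Phi> \<longlongrightarrow> 0) (inf N (filtermap f sequentially))"
    by (rule tendsto_mono[rotated]) simp
  ultimately show ?thesis using assms(1) by (blast intro: tendsto_unique)
qed

text \<open>
  A state is obtained as a pointwise cluster point of the normalised traces of the finite
  dimensional subalgebras, precomposed with nonlinear almost best approximations.
\<close>

lemma (in cstar_algebra) af_algebra_states_nonempty:
  assumes af: "af_sequence A U"
  shows "states A \<noteq> {}"
proof -
  have sub: "unital_cstar_subalgebra (U n) A" and fin: "finite_dimensional (A\<lparr>carrier := U n\<rparr>)" for n
    using af by (auto simp: af_sequence_def)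
  note subc = subalgebra_closed[OF sub]
  have inA: "x \<in> U n \<Longrightarrow> x \<in> carrier A" for x n using subc(1) by auto
  have "\<exists>\<tau>. \<tau> \<in> states (A\<lparr>carrier := U n\<rparr>) \<and> (\<forall>x\<in>U n. cmod (\<tau> x) \<le> cnorm A x)" for n
  proof -
    obtain \<tau> where "\<tau> \<in> states (A\<lparr>carrier := U n\<rparr>)"
      "\<And>x. x \<in> carrier (A\<lparr>carrier := U n\<rparr>) \<Longrightarrow> cmod (\<tau> x) \<le> cnorm (A\<lparr>carrier := U n\<rparr>) x"
      using finite_dimensional_state[OF cstar_algebra_subalgebra[OF sub] fin, of n] by blast
    then show ?thesis by (intro exI[of _ \<tau>]) simp
  qed
  then obtain \<tau> where st: "\<And>n. \<tau> n \<in> states (A\<lparr>carrier := U n\<rparr>)"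
    and bd: "\<And>n x. x \<in> U n \<Longrightarrow> cmod (\<tau> n x) \<le> cnorm A x" by metis
  have \<tau>_add: "\<tau> n (x \<oplus> y) = \<tau> n x + \<tau> n y" if "x \<in> U n" "y \<in> U n" for n x y
    using st[of n] that by (simp add: states_def)
  have \<tau>_smult: "\<tau> n (c \<odot> x) = c * \<tau> n x" if "x \<in> U n" for n c x
    using st[of n] that by (simp add: states_def)
  have \<tau>_pos: "\<tau> n (star A x \<otimes> x) \<in> \<real>\<^sub>\<ge>\<^sub>0" if "x \<in> U n" for n x
    using st[of n] that by (simp add: states_def)
  have \<tau>_one: "\<tau> n \<one> = 1" for n
    using st[of n] by (simp add: states_def)
  have \<tau>_diff: "cmod (\<tau> n x - \<tau> n y) \<le> cnorm A (x \<ominus> y)" if "x \<in> U n" "y \<in> U n" for n x y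
  proof -
    have "\<tau> n (x \<ominus> y) = \<tau> n x - \<tau> n y"
      using that \<tau>_add[of x n "(- 1) \<odot> y"] subc by (simp add: minus_eq_smult inA \<tau>_smult)
    then show ?thesis using bd[of "x \<ominus> y" n] subc(9) that by simp
  qed
  \<comment> \<open>The slack \<open>1 / Suc n\<close> makes the infimum property enough, with no
    need for it to be attained, and it vanishes in the limit.\<close>
  have "\<exists>p\<in>U n. \<forall>q\<in>U n. cnorm A (x \<ominus> p) \<le> cnorm A (x \<ominus> q) + 1 / Suc n" if x: "x \<in> carrier A" for n x
  proof -
    let ?D = "(\<lambda>q. cnorm A (x \<ominus> q)) ` U n"
    have D: "?D \<noteq> {}" "bdd_below ?D"
      using subc(2) x inA by (auto intro!: bdd_belowI[of _ 0])
    have "\<exists>d\<in>?D. d < Inf ?D + 1 / Suc n" using cInf_lessD[of ?D "Inf ?D + 1 / Suc n"] D by auto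
    then obtain p where p: "p \<in> U n" "cnorm A (x \<ominus> p) < Inf ?D + 1 / Suc n" by auto
    then show ?thesis
      using cInf_lower[OF _ D(2)] by (intro bexI[of _ p]) force+
  qed
  note best = this
  define P where "P n x = (SOME p. p \<in> U n \<and> (\<forall>q\<in>U n. cnorm A (x \<ominus> p) \<le> cnorm A (x \<ominus> q) + 1 / Suc n))" for n x
  have P: "P n x \<in> U n \<and> (\<forall>q\<in>U n. cnorm A (x \<ominus> P n x) \<le> cnorm A (x \<ominus> q) + 1 / Suc n)"
    if "x \<in> carrier A" for n x
    using someI_ex[OF best[OF that, of n, unfolded Bex_def], folded P_def] .
  have PU: "\<And>n x. x \<in> carrier A \<Longrightarrow> P n x \<in> U n"
    and Pb: "\<And>n x q. \<lbrakk>x \<in> carrier A; q \<in> U n\<rbrakk> \<Longrightarrow> cnorm A (x \<ominus> P n x) \<le> cnorm A (x \<ominus> q) + 1 / Suc n"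
    using P by simp_all
  have PA: "P n x \<in> carrier A" if "x \<in> carrier A" for n x using PU[OF that] inA by blast
  \<comment> \<open>Density supplies one good approximant \<open>q\<close>, and monotonicity of
    \<open>U\<close> keeps it a competitor at every later stage.\<close>
  have Plim: "nlim (\<lambda>n. P n x) x" if x: "x \<in> carrier A" for x
    unfolding nlim_def
  proof (rule LIMSEQ_I)
    fix e :: real assume e: "0 < e"
    have "x \<in> norm_topology A closure_of (\<Union>n. U n)" using af x by (simp add: af_sequence_def)
    moreover have "(\<Union>n. U n) \<subseteq> carrier A" using inA by blast
    ultimately have "\<exists>q\<in>\<Union>n. U n. cnorm A (x \<ominus> q) < e / 2"
      using in_closure_iff[of "\<Union>n. U n" x] half_gt_zero[OF e] by blast
    then obtain m q where q: "q \<in> U m" "cnorm A (x \<ominus> q) < e / 2" by blast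
    obtain k where k: "1 / Suc k < e / 2" using e by (metis half_gt_zero nat_approx_posE)
    have "norm (cnorm A (x \<ominus> P n x) - 0) < e" if n: "max m k \<le> n" for n
    proof -
      have "q \<in> U n" using q(1) n af by (auto simp: af_sequence_def incseq_def)
      then have "cnorm A (x \<ominus> P n x) \<le> cnorm A (x \<ominus> q) + 1 / Suc n" using Pb x by blast
      also have "1 / Suc n \<le> 1 / Suc k" using n by (simp add: frac_le)
      finally show ?thesis using q k x PA by simp
    qed
    then show "\<exists>N. \<forall>n\<ge>N. norm (cnorm A (x \<ominus> P n x) - 0) < e" by blast
  qed
  \<comment> \<open>The value 0 off the carrier makes each \<open>f n\<close> a point of a product
    over the whole type.\<close>
  define f where "f n x = (if x \<in> carrier A then \<tau> n (P n x) else 0)" for n x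
  \<comment> \<open>The radius comes from comparing \<open>P n x\<close> with
    \<open>\<zero>\<close>: the error is at most the norm of \<open>x\<close> plus 1, so
    \<open>P n x\<close> has norm at most twice that of \<open>x\<close> plus 1. Off the carrier the
    disc is a single point.\<close>
  define K where "K = PiE UNIV (\<lambda>x. cball (0::complex) (if x \<in> carrier A then 2 * cnorm A x + 1 else 0))"
  have fK: "f n \<in> K" for n
  proof -
    have "cmod (\<tau> n (P n x)) \<le> 2 * cnorm A x + 1" if x: "x \<in> carrier A" for x
    proof -
      have "cmod (\<tau> n (P n x)) \<le> cnorm A (P n x)" by (rule bd[OF PU[OF x]])
      also have "\<dots> \<le> cnorm A x + cnorm A (x \<ominus> P n x)"
        using cnorm_diff_le[OF PA[OF x] x] cnorm_minus_commute[OF PA[OF x] x] by simp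
      also have "cnorm A (x \<ominus> P n x) \<le> cnorm A x + 1 / Suc n"
        using Pb[OF x subc(3)] x by (simp add: a_minus_def)
      also have "1 / Suc n \<le> (1::real)" by simp
      finally show ?thesis by simp
    qed
    then show ?thesis by (auto simp: K_def f_def)
  qed
  have "compactin (product_topology (\<lambda>x. euclidean) UNIV) K"
    unfolding K_def compactin_PiE by simp
  then have "compact K" by (simp add: euclidean_product_topology)
  moreover have "filtermap f sequentially \<noteq> bot" by (simp add: filtermap_bot_iff)
  moreover have "eventually (\<lambda>h. h \<in> K) (filtermap f sequentially)"
    using fK by (simp add: eventually_filtermap)
  ultimately obtain g where g: "inf (nhds g) (filtermap f sequentially) \<noteq> bot"
    unfolding compact_filter by blast
  have coordlim: "((\<lambda>h. h x) \<longlongrightarrow> g x) (nhds g)" for x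
  proof (rule topological_tendstoI)
    fix S :: "complex set" assume S: "open S" "g x \<in> S"
    have "open ((\<lambda>h :: 'a \<Rightarrow> complex. h x) -` S)"
      using S(1) by (rule open_vimage) (rule continuous_on_product_coordinates)
    then show "eventually (\<lambda>h. h x \<in> S) (nhds g)"
      using eventually_nhds_in_open[of "(\<lambda>h. h x) -` S" g] S(2) by simp
  qed
  note zeroI = tendsto_cluster_zero[OF g]
  \<comment> \<open>\<open>P n\<close> is not linear, multiplicative or compatible with the
    involution. This repairs it asymptotically: since \<open>\<tau> n\<close> is a contraction, any
    sequence in the \<open>U n\<close> tending to \<open>z\<close> may replace
    \<open>P n z\<close>.\<close>
  have key: "(\<lambda>n. \<tau> n (q n) - f n z) \<longlonglongrightarrow> 0"
    if z: "z \<in> carrier A" and q: "\<And>n. q n \<in> U n" and lim: "nlim q z" for z q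
  proof (rule Lim_null_comparison[OF always_eventually])
    have qA: "q n \<in> carrier A" for n by (rule inA[OF q])
    show "\<forall>n. norm (\<tau> n (q n) - f n z) \<le> cnorm A (z \<ominus> q n) + cnorm A (z \<ominus> P n z)"
    proof
      fix n
      have "norm (\<tau> n (q n) - f n z) \<le> cnorm A (q n \<ominus> P n z)"
        using \<tau>_diff[OF q PU[OF z]] z by (simp add: f_def)
      also have "\<dots> \<le> cnorm A (q n \<ominus> z) + cnorm A (z \<ominus> P n z)"
        by (rule cnorm_minus_triangle) (use z PA qA in auto)
      finally show "norm (\<tau> n (q n) - f n z) \<le> cnorm A (z \<ominus> q n) + cnorm A (z \<ominus> P n z)"
        using cnorm_minus_commute[of z "q n"] z qA by simp
    qed
    show "(\<lambda>n. cnorm A (z \<ominus> q n) + cnorm A (z \<ominus> P n z)) \<longlonglongrightarrow> 0"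
      using tendsto_add_zero[OF lim[unfolded nlim_def] Plim[OF z, unfolded nlim_def]] .
  qed
  have g_add: "g (x \<oplus> y) = g x + g y" if x: "x \<in> carrier A" and y: "y \<in> carrier A" for x y
  proof -
    have "nlim (\<lambda>n. P n x \<oplus> P n y) (x \<oplus> y)"
      by (rule nlim_add) (use x y in \<open>auto simp: PA Plim\<close>)
    then have "(\<lambda>n. \<tau> n (P n x \<oplus> P n y) - f n (x \<oplus> y)) \<longlonglongrightarrow> 0"
      using x y by (intro key) (auto simp: PU subc)
    then have "(\<lambda>n. f n x + f n y - f n (x \<oplus> y)) \<longlonglongrightarrow> 0"
      using x y by (simp add: f_def \<tau>_add PU)
    then have "g x + g y - g (x \<oplus> y) = 0"
      by (rule zeroI[rotated]) (intro tendsto_intros coordlim)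
    then show ?thesis by simp
  qed
  have g_smult: "g (c \<odot> x) = c * g x" if x: "x \<in> carrier A" for c x
  proof -
    have "nlim (\<lambda>n. c \<odot> P n x) (c \<odot> x)"
      by (rule nlim_smult) (use x in \<open>auto simp: PA Plim\<close>)
    then have "(\<lambda>n. \<tau> n (c \<odot> P n x) - f n (c \<odot> x)) \<longlonglongrightarrow> 0"
      using x by (intro key) (auto simp: PU subc)
    then have "(\<lambda>n. c * f n x - f n (c \<odot> x)) \<longlonglongrightarrow> 0"
      using x by (simp add: f_def \<tau>_smult PU)
    then have "c * g x - g (c \<odot> x) = 0"
      by (rule zeroI[rotated]) (intro tendsto_intros coordlim)
    then show ?thesis by simp
  qed
  have g_one: "g \<one> = 1"
  proof -
    have "(\<lambda>n. \<tau> n \<one> - f n \<one>) \<longlonglongrightarrow> 0" by (intro key) (auto simp: subc nlim_const)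
    then have "(\<lambda>n. 1 - f n \<one>) \<longlonglongrightarrow> 0" by (simp add: \<tau>_one)
    then have "1 - g \<one> = 0"
      by (rule zeroI[rotated]) (intro tendsto_intros coordlim)
    then show ?thesis by simp
  qed
  have g_pos: "g (star A x \<otimes> x) \<in> \<real>\<^sub>\<ge>\<^sub>0" if x: "x \<in> carrier A" for x
  proof -
    let ?z = "star A x \<otimes> x"
    define q where "q n = star A (P n x) \<otimes> P n x" for n
    have "nlim (\<lambda>n. star A (P n x)) (star A x)"
      by (rule nlim_star) (use x in \<open>auto simp: PA Plim\<close>)
    then have "nlim q ?z"
      unfolding q_def by (intro nlim_mult) (use x in \<open>auto simp: PA Plim star_closed\<close>)
    then have lim: "(\<lambda>n. \<tau> n (q n) - f n ?z) \<longlonglongrightarrow> 0"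
      by (rule key[rotated 2]) (use x in \<open>auto simp: PU subc q_def star_closed\<close>)
    have pos: "\<tau> n (q n) \<in> \<real>\<^sub>\<ge>\<^sub>0" for n using \<tau>_pos[OF PU[OF x]] by (simp add: q_def)
    \<comment> \<open>\<open>zeroI\<close> only transfers null limits to \<open>g\<close>, so
      nonnegativity is encoded as the vanishing of \<open>Im\<close> and of
      \<open>min (Re _) 0\<close>. Both are dominated by the distance to the nonnegative number
      \<open>\<tau> n (q n)\<close>.\<close>
    have "(\<lambda>n. Im (f n ?z)) \<longlonglongrightarrow> 0"
    proof (rule Lim_null_comparison[OF always_eventually tendsto_norm_zero[OF lim]], rule allI)
      fix n
      show "norm (Im (f n ?z)) \<le> norm (\<tau> n (q n) - f n ?z)"
        using abs_Im_le_cmod[of "\<tau> n (q n) - f n ?z"] pos[of n] by (simp add: complex_nonneg_Reals_iff)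
    qed
    then have "Im (g ?z) = 0" by (rule zeroI[rotated]) (intro tendsto_intros coordlim)
    moreover have "(\<lambda>n. min (Re (f n ?z)) 0) \<longlonglongrightarrow> 0"
    proof (rule Lim_null_comparison[OF always_eventually tendsto_norm_zero[OF lim]], rule allI)
      fix n
      show "norm (min (Re (f n ?z)) 0) \<le> norm (\<tau> n (q n) - f n ?z)"
        using abs_Re_le_cmod[of "\<tau> n (q n) - f n ?z"] pos[of n] by (auto simp: complex_nonneg_Reals_iff)
    qed
    then have "min (Re (g ?z)) 0 = 0" by (rule zeroI[rotated]) (intro tendsto_intros coordlim)
    ultimately show ?thesis by (simp add: complex_nonneg_Reals_iff)
  qed
  have "restrict g (carrier A) \<in> states A"
    by (simp add: states_def g_add g_smult g_one g_pos star_closed)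
  then show ?thesis by blast
qed

section \<open>Extension to the closure of the union\<close>

lemma star_homD:
  assumes "p \<in> star_hom A B"
  shows "x \<in> carrier A \<Longrightarrow> p x \<in> carrier B"
    and "\<lbrakk>x \<in> carrier A; y \<in> carrier A\<rbrakk> \<Longrightarrow> p (x \<oplus>\<^bsub>A\<^esub> y) = p x \<oplus>\<^bsub>B\<^esub> p y"
    and "\<lbrakk>x \<in> carrier A; y \<in> carrier A\<rbrakk> \<Longrightarrow> p (x \<otimes>\<^bsub>A\<^esub> y) = p x \<otimes>\<^bsub>B\<^esub> p y"
    and "x \<in> carrier A \<Longrightarrow> p (c \<odot>\<^bsub>A\<^esub> x) = c \<odot>\<^bsub>B\<^esub> p x"
    and "x \<in> carrier A \<Longrightarrow> p (star A x) = star B (p x)"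
    and "p \<one>\<^bsub>A\<^esub> = \<one>\<^bsub>B\<^esub>"
  using assms by (auto simp: star_hom_def Ring.ring_hom_def)

lemma star_homI:
  assumes "\<And>x. x \<in> carrier A \<Longrightarrow> p x \<in> carrier B"
    and "\<And>x y. \<lbrakk>x \<in> carrier A; y \<in> carrier A\<rbrakk> \<Longrightarrow> p (x \<oplus>\<^bsub>A\<^esub> y) = p x \<oplus>\<^bsub>B\<^esub> p y"
    and "\<And>x y. \<lbrakk>x \<in> carrier A; y \<in> carrier A\<rbrakk> \<Longrightarrow> p (x \<otimes>\<^bsub>A\<^esub> y) = p x \<otimes>\<^bsub>B\<^esub> p y"
    and "\<And>c x. x \<in> carrier A \<Longrightarrow> p (c \<odot>\<^bsub>A\<^esub> x) = c \<odot>\<^bsub>B\<^esub> p x"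
    and "\<And>x. x \<in> carrier A \<Longrightarrow> p (star A x) = star B (p x)"
    and "p \<one>\<^bsub>A\<^esub> = \<one>\<^bsub>B\<^esub>"
  shows "p \<in> star_hom A B"
  using assms by (auto simp: star_hom_def Ring.ring_hom_def)

lemma star_hom_minus:
  assumes "cstar_algebra A" "cstar_algebra B" "p \<in> star_hom A B" "x \<in> carrier A" "y \<in> carrier A"
  shows "p (x \<ominus>\<^bsub>A\<^esub> y) = p x \<ominus>\<^bsub>B\<^esub> p y"
proof -
  interpret AA: cstar_algebra A by fact
  interpret BB: cstar_algebra B by fact
  show ?thesis using assms(4,5)
    by (simp add: AA.minus_eq_smult BB.minus_eq_smult star_homD[OF assms(3)])
qed

lemma star_iso_inv:
  assumes A: "cstar_algebra A" and p: "p \<in> star_iso A B"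
  shows "inv_into (carrier A) p \<in> star_iso B A"
proof -
  interpret AA: cstar_algebra A by fact
  let ?q = "inv_into (carrier A) p"
  have h: "p \<in> star_hom A B" and b: "bij_betw p (carrier A) (carrier B)"
    using p by (auto simp: star_iso_def)
  note ph = star_homD[OF h]
  have qc: "?q y \<in> carrier A" and pq: "p (?q y) = y" if "y \<in> carrier B" for y
    using b that by (auto simp: bij_betw_def inv_into_into f_inv_into_f)
  have qp: "?q y = x" if "x \<in> carrier A" "p x = y" for x y
    using b that by (auto simp: bij_betw_def inv_into_f_f)
  have "?q \<in> star_hom B A"
    by (rule star_homI) (auto simp: qc pq ph AA.star_closed intro!: qp)
  then show ?thesis using bij_betw_inv_into[OF b] by (simp add: star_iso_def)
qed

text \<open>Contractivity is applied to \<open>p\<close> and to its inverse, which is why both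
  algebras are finite dimensional.\<close>

lemma star_iso_isometric:
  assumes "cstar_algebra A" "cstar_algebra B" "finite_dimensional A" "finite_dimensional B"
    and p: "p \<in> star_iso A B" and x: "x \<in> carrier A"
  shows "cnorm B (p x) = cnorm A x"
proof (rule antisym)
  have h: "p \<in> star_hom A B" and b: "bij_betw p (carrier A) (carrier B)"
    using p by (auto simp: star_iso_def)
  show "cnorm B (p x) \<le> cnorm A x" using assms h by (intro star_hom_contractive) auto
  have "inv_into (carrier A) p \<in> star_hom B A"
    using star_iso_inv[OF assms(1) p] by (simp add: star_iso_def)
  then have "cnorm A (inv_into (carrier A) p (p x)) \<le> cnorm B (p x)"
    using assms star_homD(1)[OF h x] by (intro star_hom_contractive) auto
  then show "cnorm A x \<le> cnorm B (p x)" using b x by (simp add: bij_betw_def)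
qed

text \<open>Serves twice: to make \<open>\<phi>\<close> isometric on each \<open>U n\<close>, and to
  restrict the final isomorphism to the subalgebras.\<close>

lemma star_iso_restrict:
  assumes p: "p \<in> star_mono A B" and S: "S \<subseteq> carrier A" and im: "p ` S = T"
  shows "p \<in> star_iso (A\<lparr>carrier := S\<rparr>) (B\<lparr>carrier := T\<rparr>)"
proof -
  have h: "p \<in> star_hom A B" and i: "inj_on p (carrier A)" using p by (auto simp: star_mono_def)
  have "p \<in> star_hom (A\<lparr>carrier := S\<rparr>) (B\<lparr>carrier := T\<rparr>)"
    by (rule star_homI) (use star_homD[OF h] S im in \<open>auto simp: subset_iff\<close>)
  then show ?thesis using i S im by (auto simp: star_iso_def bij_betw_def intro: inj_on_subset)
qed

text \<open>
  The isomorphism relates x to y whenever some sequence in the union of the subalgebras tends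
  to x while its image tends to y; isometry makes this relation a bijection.
\<close>

lemma af_star_iso:
  assumes A: "cstar_algebra A" and U: "af_sequence A U"
    and B: "cstar_algebra B" and V: "af_sequence B V"
    and p: "p \<in> star_mono A B" and im: "\<And>n. p ` U n = V n"
  obtains \<pi> where "\<pi> \<in> star_iso A B" "\<And>x. x \<in> carrier A \<Longrightarrow> cnorm B (\<pi> x) = cnorm A x"
    "\<And>n x. x \<in> U n \<Longrightarrow> \<pi> x = p x"
proof -
  interpret AA: cstar_algebra A by fact
  interpret BB: cstar_algebra B by fact
  have h: "p \<in> star_hom A B" using p by (simp add: star_mono_def)
  note ph = star_homD[OF h]
  have subU: "unital_cstar_subalgebra (U n) A" and finU: "finite_dimensional (A\<lparr>carrier := U n\<rparr>)" for n
    using U by (auto simp: af_sequence_def)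
  have subV: "unital_cstar_subalgebra (V n) B" and finV: "finite_dimensional (B\<lparr>carrier := V n\<rparr>)" for n
    using V by (auto simp: af_sequence_def)
  note Uc = AA.subalgebra_closed[OF subU]
  define D where "D = (\<Union>n. U n)"
  have DA: "D \<subseteq> carrier A" using Uc(1) by (auto simp: D_def)
  have DAx: "x \<in> carrier A" if "x \<in> D" for x using DA that by blast
  have D2: "\<exists>n. x \<in> U n \<and> y \<in> U n" if xy: "x \<in> D" "y \<in> D" for x y
  proof -
    obtain m n where "x \<in> U m" "y \<in> U n" using xy by (auto simp: D_def)
    moreover have "incseq U" using U by (simp add: af_sequence_def)
    then have "U m \<subseteq> U (max m n)" "U n \<subseteq> U (max m n)" by (simp_all add: incseqD)
    ultimately show ?thesis by blast
  qed
  have D_add: "x \<oplus>\<^bsub>A\<^esub> y \<in> D" if "x \<in> D" "y \<in> D" for x y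
    using D2[OF that] Uc(4) by (auto simp: D_def)
  have D_mult: "x \<otimes>\<^bsub>A\<^esub> y \<in> D" if "x \<in> D" "y \<in> D" for x y
    using D2[OF that] Uc(5) by (auto simp: D_def)
  have D_minus: "x \<ominus>\<^bsub>A\<^esub> y \<in> D" if "x \<in> D" "y \<in> D" for x y
    using D2[OF that] Uc(9) by (auto simp: D_def)
  have D_smult: "c \<odot>\<^bsub>A\<^esub> x \<in> D" if "x \<in> D" for c x using that Uc(6) by (auto simp: D_def)
  have D_star: "star A x \<in> D" if "x \<in> D" for x using that Uc(7) by (auto simp: D_def)
  have D_one: "\<one>\<^bsub>A\<^esub> \<in> D" using Uc(2) by (auto simp: D_def)
  have iso: "cnorm B (p x) = cnorm A x" if xD: "x \<in> D" for x
  proof -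
    obtain n where n: "x \<in> U n" using xD by (auto simp: D_def)
    have "cnorm (B\<lparr>carrier := V n\<rparr>) (p x) = cnorm (A\<lparr>carrier := U n\<rparr>) x"
      by (rule star_iso_isometric[OF AA.cstar_algebra_subalgebra[OF subU]
            BB.cstar_algebra_subalgebra[OF subV] finU finV star_iso_restrict[OF p Uc(1) im]])
        (simp add: n)
    then show ?thesis by simp
  qed
  have iso2: "cnorm B (p x \<ominus>\<^bsub>B\<^esub> p y) = cnorm A (x \<ominus>\<^bsub>A\<^esub> y)" if "x \<in> D" "y \<in> D" for x y
    using iso[OF D_minus[OF that]] star_hom_minus[OF A B h] that DAx by simp
  define R where "R x y \<longleftrightarrow> x \<in> carrier A \<and> y \<in> carrier B \<and>
    (\<exists>u. (\<forall>n. u n \<in> D) \<and> AA.nlim u x \<and> BB.nlim (\<lambda>n. p (u n)) y)" for x y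
  have RI: "R x y" if "x \<in> carrier A" "y \<in> carrier B" "\<And>n. u n \<in> D" "AA.nlim u x"
      "BB.nlim (\<lambda>n. p (u n)) y" for u x y
    unfolding R_def using that by (intro conjI exI[of _ u]) auto
  have cauchy: "BB.ncauchy (\<lambda>n. p (u n)) \<longleftrightarrow> AA.ncauchy u" if "\<And>n. u n \<in> D" for u
    using that by (simp add: AA.ncauchy_def BB.ncauchy_def iso2)
  have R_left: "\<exists>y. R x y" if x: "x \<in> carrier A" for x
  proof -
    have "x \<in> norm_topology A closure_of D" using U x by (simp add: af_sequence_def D_def)
    then obtain u where u: "\<And>n. u n \<in> D" "AA.nlim u x" using AA.in_closure_nlim[OF DA] by blast
    have "AA.ncauchy u" by (rule AA.nlim_imp_ncauchy[OF x _ u(2)]) (simp_all add: u DAx)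
    then have "BB.ncauchy (\<lambda>n. p (u n))" using cauchy u(1) by blast
    moreover have "p (u n) \<in> carrier B" for n using u(1) DAx ph(1) by blast
    ultimately obtain y where "y \<in> carrier B" "BB.nlim (\<lambda>n. p (u n)) y"
      using BB.ncauchy_convergent[of "\<lambda>n. p (u n)"] by blast
    then show ?thesis using x u unfolding R_def by blast
  qed
  have R_right: "\<exists>x. R x y" if y: "y \<in> carrier B" for y
  proof -
    have pD: "(\<Union>n. V n) = p ` D" by (simp add: D_def image_UN im)
    have "y \<in> norm_topology B closure_of (p ` D)" using V y by (simp add: af_sequence_def flip: pD)
    moreover have pDB: "p ` D \<subseteq> carrier B" using DAx ph(1) by blast
    ultimately obtain v where v: "\<And>n. v n \<in> p ` D" "BB.nlim v y" using BB.in_closure_nlim by blast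
    have "\<forall>n. \<exists>w. w \<in> D \<and> p w = v n"
    proof
      fix n
      from v(1)[of n] obtain w where "w \<in> D" "v n = p w" by (rule imageE)
      then show "\<exists>w. w \<in> D \<and> p w = v n" by auto
    qed
    then obtain u where u: "\<And>n. u n \<in> D" "\<And>n. p (u n) = v n" by metis
    have vB: "v n \<in> carrier B" for n using v(1) pDB by blast
    have "BB.ncauchy v" by (rule BB.nlim_imp_ncauchy[OF y _ v(2)]) (simp_all add: vB)
    then have "AA.ncauchy u" using cauchy[of u] u by simp
    then obtain x where "x \<in> carrier A" "AA.nlim u x"
      using AA.ncauchy_convergent[of u] u(1) DAx by blast
    then have "R x y" by (intro RI[of x y u]) (simp_all add: y u v(2))
    then show ?thesis ..
  qed
  \<comment> \<open>This one identity yields uniqueness of \<open>y\<close> given \<open>x\<close>,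
    injectivity, and, compared with the pair of zeros, preservation of norms.\<close>
  have R_dist: "cnorm B (y \<ominus>\<^bsub>B\<^esub> y') = cnorm A (x \<ominus>\<^bsub>A\<^esub> x')" if R: "R x y" "R x' y'" for x y x' y'
  proof -
    obtain u where u: "\<And>n. u n \<in> D" "AA.nlim u x" "BB.nlim (\<lambda>n. p (u n)) y"
      using R(1) unfolding R_def by blast
    obtain v where v: "\<And>n. v n \<in> D" "AA.nlim v x'" "BB.nlim (\<lambda>n. p (v n)) y'"
      using R(2) unfolding R_def by blast
    have c: "x \<in> carrier A" "x' \<in> carrier A" "y \<in> carrier B" "y' \<in> carrier B" using R by (auto simp: R_def)
    have "(\<lambda>n. cnorm A (u n \<ominus>\<^bsub>A\<^esub> v n)) \<longlonglongrightarrow> cnorm A (x \<ominus>\<^bsub>A\<^esub> x')"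
      by (rule AA.nlim_dist) (use u v c DAx in auto)
    moreover have "(\<lambda>n. cnorm B (p (u n) \<ominus>\<^bsub>B\<^esub> p (v n))) \<longlonglongrightarrow> cnorm B (y \<ominus>\<^bsub>B\<^esub> y')"
      by (rule BB.nlim_dist) (use u v c DAx ph(1) in auto)
    ultimately show ?thesis using u(1) v(1) by (simp add: iso2 LIMSEQ_unique)
  qed
  have R_unique: "y = y'" if "R x y" "R x y'" for x y y'
    using R_dist[OF that] that by (auto simp: R_def BB.r_right_minus_eq)
  define \<pi> where "\<pi> x = (SOME y. R x y)" for x
  have R_pi: "R x (\<pi> x)" if "x \<in> carrier A" for x
    unfolding \<pi>_def by (rule someI_ex[OF R_left[OF that]])
  have piI: "\<pi> x = y" if "R x y" for x y
    using R_unique[OF R_pi that] that by (simp add: R_def)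
  have R_D: "R x (p x)" if "x \<in> D" for x
    by (rule RI[of _ _ "\<lambda>n. x"]) (simp_all add: that DAx ph(1) AA.nlim_const BB.nlim_const)
  have R_ops: "R (x \<oplus>\<^bsub>A\<^esub> x') (y \<oplus>\<^bsub>B\<^esub> y')" "R (x \<otimes>\<^bsub>A\<^esub> x') (y \<otimes>\<^bsub>B\<^esub> y')"
    "R (k \<odot>\<^bsub>A\<^esub> x) (k \<odot>\<^bsub>B\<^esub> y)" "R (star A x) (star B y)" if R: "R x y" "R x' y'" for x y x' y' k
  proof -
    obtain u where u: "\<And>n. u n \<in> D" "AA.nlim u x" "BB.nlim (\<lambda>n. p (u n)) y"
      using R(1) unfolding R_def by blast
    obtain v where v: "\<And>n. v n \<in> D" "AA.nlim v x'" "BB.nlim (\<lambda>n. p (v n)) y'"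
      using R(2) unfolding R_def by blast
    have c: "x \<in> carrier A" "x' \<in> carrier A" "y \<in> carrier B" "y' \<in> carrier B" using R by (auto simp: R_def)
    have uv: "u n \<in> carrier A" "v n \<in> carrier A" "p (u n) \<in> carrier B" "p (v n) \<in> carrier B" for n
      using u(1) v(1) DAx ph(1) by blast+
    note lA = c(1,2) uv(1,2) u(2) v(2) and lB = c(3,4) uv(3,4) u(3) v(3)
    show "R (x \<oplus>\<^bsub>A\<^esub> x') (y \<oplus>\<^bsub>B\<^esub> y')"
      by (rule RI[of _ _ "\<lambda>n. u n \<oplus>\<^bsub>A\<^esub> v n"])
        (use AA.nlim_add[OF lA] BB.nlim_add[OF lB] in
          \<open>simp_all add: c u(1) v(1) D_add ph uv AA.star_closed BB.star_closed\<close>)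
    show "R (x \<otimes>\<^bsub>A\<^esub> x') (y \<otimes>\<^bsub>B\<^esub> y')"
      by (rule RI[of _ _ "\<lambda>n. u n \<otimes>\<^bsub>A\<^esub> v n"])
        (use AA.nlim_mult[OF lA] BB.nlim_mult[OF lB] in
          \<open>simp_all add: c u(1) v(1) D_mult ph uv AA.star_closed BB.star_closed\<close>)
    show "R (k \<odot>\<^bsub>A\<^esub> x) (k \<odot>\<^bsub>B\<^esub> y)"
      by (rule RI[of _ _ "\<lambda>n. k \<odot>\<^bsub>A\<^esub> u n"])
        (use AA.nlim_smult[OF c(1) uv(1) u(2), of k] BB.nlim_smult[OF c(3) uv(3) u(3), of k] in
          \<open>simp_all add: c u(1) v(1) D_smult ph uv AA.star_closed BB.star_closed\<close>)
    show "R (star A x) (star B y)"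
      by (rule RI[of _ _ "\<lambda>n. star A (u n)"])
        (use AA.nlim_star[OF c(1) uv(1) u(2)] BB.nlim_star[OF c(3) uv(3) u(3)] in
          \<open>simp_all add: c u(1) v(1) D_star ph uv AA.star_closed BB.star_closed\<close>)
  qed
  have R_B: "\<pi> x \<in> carrier B" if "x \<in> carrier A" for x using R_pi[OF that] by (simp add: R_def)
  have "\<pi> \<in> star_hom A B"
  proof (rule star_homI)
    show "\<pi> \<one>\<^bsub>A\<^esub> = \<one>\<^bsub>B\<^esub>" using R_D[OF D_one] by (intro piI) (simp add: ph)
  qed (auto intro!: piI R_ops R_pi R_B)
  moreover have "bij_betw \<pi> (carrier A) (carrier B)"
  proof (rule bij_betw_imageI)
    show "inj_on \<pi> (carrier A)"
    proof (rule inj_onI)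
      fix x y assume xy: "x \<in> carrier A" "y \<in> carrier A" "\<pi> x = \<pi> y"
      then have "cnorm A (x \<ominus>\<^bsub>A\<^esub> y) = 0" using R_dist[OF R_pi[OF xy(1)] R_pi[OF xy(2)]] R_B by simp
      then show "x = y" using xy by (simp add: AA.r_right_minus_eq)
    qed
    show "\<pi> ` carrier A = carrier B"
    proof (intro equalityI subsetI)
      fix y assume "y \<in> carrier B"
      then obtain x where "R x y" using R_right by blast
      then show "y \<in> \<pi> ` carrier A" using piI by (force simp: R_def)
    qed (use R_B in auto)
  qed
  ultimately have 1: "\<pi> \<in> star_iso A B" by (simp add: star_iso_def)
  have pi_D: "\<pi> x = p x" if "x \<in> D" for x by (rule piI[OF R_D[OF that]])
  have 2: "cnorm B (\<pi> x) = cnorm A x" if x: "x \<in> carrier A" for x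
  proof -
    have "\<zero>\<^bsub>A\<^esub> \<in> D" using Uc(3) by (auto simp: D_def)
    moreover have "p \<zero>\<^bsub>A\<^esub> = \<zero>\<^bsub>B\<^esub>" using ph(4)[of "\<zero>\<^bsub>A\<^esub>" 0] ph(1) by simp
    ultimately have "R \<zero>\<^bsub>A\<^esub> \<zero>\<^bsub>B\<^esub>" using R_D by force
    from R_dist[OF R_pi[OF x] this] show ?thesis
      using x R_B[OF x] by (simp add: a_minus_def)
  qed
  have 3: "\<pi> x = p x" if "x \<in> U n" for n x by (rule pi_D) (use that in \<open>auto simp: D_def\<close>)
  show thesis by (rule that[OF 1 2 3])
qed

section \<open>Lip-norms and bridges\<close>

lemma star_iso_sa_iff:
  assumes A: "cstar_algebra A" and p: "p \<in> star_iso A B" and x: "x \<in> carrier A"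
  shows "p x \<in> sa B \<longleftrightarrow> x \<in> sa A"
proof -
  have h: "p \<in> star_hom A B" and i: "inj_on p (carrier A)"
    using p by (auto simp: star_iso_def bij_betw_def)
  have "star A x \<in> carrier A" using cstar_algebra.star_closed[OF A x] .
  then have "star B (p x) = p x \<longleftrightarrow> star A x = x"
    using star_homD(5)[OF h x] i x by (metis inj_onD)
  then show ?thesis using x star_homD(1)[OF h x] by (simp add: sa_def)
qed

text \<open>Transport of structure: quotient norms, self-adjointness, membership in the union, norm
  closure and real scaling are all respected by an isometric *-isomorphism matching the two
  filtrations.\<close>

lemma lip_closed_star_iso:
  assumes A: "cstar_algebra A" and B: "cstar_algebra B" and p: "p \<in> star_iso A B"
    and iso: "\<And>x. x \<in> carrier A \<Longrightarrow> cnorm B (p x) = cnorm A x"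
    and U: "\<And>n. U n \<subseteq> carrier A" and V: "\<And>n. V n = p ` U n" and a: "a \<in> carrier A"
  shows "lip_closed B V \<beta> (p a) = lip_closed A U \<beta> a"
proof -
  interpret AA: cstar_algebra A by fact
  interpret BB: cstar_algebra B by fact
  have h: "p \<in> star_hom A B" using p by (auto simp: star_iso_def)
  note ph = star_homD[OF h]
  have dist: "cnorm B (p x \<ominus>\<^bsub>B\<^esub> p y) = cnorm A (x \<ominus>\<^bsub>A\<^esub> y)" if "x \<in> carrier A" "y \<in> carrier A" for x y
    using iso[of "x \<ominus>\<^bsub>A\<^esub> y"] that by (simp add: star_hom_minus[OF A B h])
  have quot: "quotient_norm B (V n) (p x) = quotient_norm A (U n) x" if "x \<in> carrier A" for n x
    unfolding quotient_norm_def V image_image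
    using that U[of n] by (intro INF_cong) (auto simp: dist subset_iff)
  have lip: "lip_quot B V \<beta> (p x) = lip_quot A U \<beta> x" if "x \<in> carrier A" for x
    using that by (simp add: lip_quot_def quot)
  define S where "S = {x \<in> sa A. x \<in> (\<Union>n. U n) \<and> lip_quot A U \<beta> x \<le> 1}"
  have SA: "S \<subseteq> carrier A" by (auto simp: S_def sa_def)
  have T: "{x \<in> sa B. x \<in> (\<Union>n. V n) \<and> lip_quot B V \<beta> x \<le> 1} = p ` S" (is "?T = _")
  proof (intro equalityI subsetI)
    fix y assume y: "y \<in> ?T"
    then obtain n x where x: "x \<in> U n" "y = p x" by (auto simp: V)
    then have xA: "x \<in> carrier A" using U by blast
    then have "x \<in> S"
      using y x star_iso_sa_iff[OF A p xA] by (auto simp: S_def lip)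
    then show "y \<in> p ` S" using x by blast
  next
    fix y assume "y \<in> p ` S"
    then obtain x where x: "x \<in> S" "y = p x" by blast
    then have xA: "x \<in> carrier A" using SA by blast
    then show "y \<in> ?T"
      using x star_iso_sa_iff[OF A p xA] by (auto simp: S_def lip V)
  qed
  \<comment> \<open>Written with distances, membership in the closure is invariant under
    isometry.\<close>
  have cl: "p x \<in> norm_topology B closure_of (p ` S) \<longleftrightarrow> x \<in> norm_topology A closure_of S"
    if x: "x \<in> carrier A" for x
  proof -
    have "p ` S \<subseteq> carrier B" using SA ph(1) by blast
    then have "p x \<in> norm_topology B closure_of (p ` S) \<longleftrightarrow> (\<forall>e>0. \<exists>y\<in>S. cnorm B (p x \<ominus>\<^bsub>B\<^esub> p y) < e)"
      using x ph(1) by (simp add: BB.in_closure_iff)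
    also have "\<dots> \<longleftrightarrow> (\<forall>e>0. \<exists>y\<in>S. cnorm A (x \<ominus>\<^bsub>A\<^esub> y) < e)"
      using x SA by (simp add: dist subset_iff cong: bex_cong)
    finally show ?thesis using x by (simp add: AA.in_closure_iff[OF SA])
  qed
  show ?thesis
    unfolding lip_closed_def T unfolding S_def[symmetric] using a by (simp add: cl flip: ph(4))
qed

section \<open>Bridges of length zero\<close>

lemma mk_self [simp]: "mk A L \<phi> \<phi> = 0"
  by (simp add: mk_def SUP_constant bot_ennreal)

lemma hausdorff_eq_zero:
  assumes "\<And>s. s \<in> S \<Longrightarrow> \<exists>t\<in>T. d s t = 0" "\<And>t. t \<in> T \<Longrightarrow> \<exists>s\<in>S. d s t = 0"
  shows "hausdorff d S T = 0"
proof -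
  have "(INF t\<in>T. d s t) \<le> 0" if "s \<in> S" for s
    using assms(1)[OF that] by (metis INF_lower)
  then have 1: "(SUP s\<in>S. INF t\<in>T. d s t) \<le> 0" by (rule SUP_least)
  have "(INF s\<in>S. d s t) \<le> 0" if "t \<in> T" for t
    using assms(2)[OF that] by (metis (no_types, lifting) INF_lower)
  then have "(SUP t\<in>T. INF s\<in>S. d s t) \<le> 0" by (rule SUP_least)
  with 1 show ?thesis by (simp only: hausdorff_def le_zero_eq max.idem)
qed

lemma states_compose:
  assumes A: "cstar_algebra A" and p: "p \<in> star_hom A B" and \<phi>: "\<phi> \<in> states B"
  shows "compose (carrier A) \<phi> p \<in> states A"
proof -
  interpret cstar_algebra A by fact
  note ph = star_homD[OF p]
  show ?thesis using \<phi>
    by (auto simp: states_def compose_eq ph star_closed)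
qed

text \<open>
  A quantum isometry \<open>\<pi>\<close> gives the bridge with pivot 1 in the target algebra, along \<open>\<pi>\<close> and the
  identity. Its length is zero; it is a bridge because the target algebra has a state.
\<close>

lemma propinquity_quantum_isometry:
  fixes X Y :: "'u lip_space"
  assumes X: "cstar_algebra (fst X)" and Y: "cstar_algebra (fst Y)"
    and ne: "states (fst Y) \<noteq> {}" and q: "quantum_isometry X Y \<pi>"
  shows "propinquity C D X Y = 0"
proof -
  define A B where "A = fst X" and "B = fst Y"
  interpret AA: cstar_algebra A using X by (simp add: A_def)
  interpret BB: cstar_algebra B using Y by (simp add: B_def)
  have p: "\<pi> \<in> star_iso A B" and L: "\<And>a. a \<in> sa A \<Longrightarrow> snd Y (\<pi> a) = snd X a"
    using q by (auto simp: quantum_isometry_def A_def B_def)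
  have h: "\<pi> \<in> star_hom A B" and b: "bij_betw \<pi> (carrier A) (carrier B)" using p by (auto simp: star_iso_def)
  note ph = star_homD[OF h]
  define p' where "p' = inv_into (carrier A) \<pi>"
  have p': "p' \<in> star_hom B A"
    using star_iso_inv[OF AA.cstar_algebra_axioms p] by (simp add: p'_def star_iso_def)
  have p'p: "p' (\<pi> x) = x" if "x \<in> carrier A" for x
    using b that by (simp add: p'_def bij_betw_def)
  have surj: "\<exists>x\<in>carrier A. y = \<pi> x" if "y \<in> carrier B" for y
    using b that by (auto simp: bij_betw_def)
  have id: "(\<lambda>x. x) \<in> star_hom B B" by (rule star_homI) auto
  \<comment> \<open>With pivot 1 both defining conditions ask a state to vanish at zero, so every
    state qualifies.\<close>
  have s1: "states_1 B \<one>\<^bsub>B\<^esub> = states B"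
  proof -
    have "\<phi> \<zero>\<^bsub>B\<^esub> = 0" if \<phi>: "\<phi> \<in> states B" for \<phi>
    proof -
      have "\<phi> (0 \<odot>\<^bsub>B\<^esub> \<zero>\<^bsub>B\<^esub>) = 0 * \<phi> \<zero>\<^bsub>B\<^esub>"
        using \<phi> unfolding states_def by blast
      then show ?thesis by simp
    qed
    then show ?thesis by (auto simp: states_1_def)
  qed
  have bridge: "bridge A B B \<pi> (\<lambda>x. x) \<one>\<^bsub>B\<^esub>"
    using h b id ne by (auto simp: bridge_def star_mono_def s1 bij_betw_def BB.cstar_algebra_axioms B_def[symmetric])
  \<comment> \<open>As \<open>\<pi>\<close> is onto, a state of \<open>A\<close> is pulled back
    along the inverse, so no extension theorem for states is involved. Each state is then its own
    partner at distance 0 in the height.\<close>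
  have "{compose (carrier A) \<phi> \<pi> | \<phi>. \<phi> \<in> states B} = states A"
  proof (intro equalityI subsetI)
    fix \<psi> assume \<psi>: "\<psi> \<in> states A"
    have "compose (carrier A) (compose (carrier B) \<psi> p') \<pi> = \<psi>"
    proof (rule extensionalityI[of _ "carrier A"])
      show "\<psi> \<in> extensional (carrier A)" using \<psi> by (simp add: states_def)
    qed (auto simp: compose_eq ph p'p)
    moreover have "compose (carrier B) \<psi> p' \<in> states B"
      by (rule states_compose[OF BB.cstar_algebra_axioms p' \<psi>])
    ultimately have "\<exists>\<phi>. \<psi> = compose (carrier A) \<phi> \<pi> \<and> \<phi> \<in> states B" by metis
    then show "\<psi> \<in> {compose (carrier A) \<phi> \<pi> | \<phi>. \<phi> \<in> states B}" by (simp only: mem_Collect_eq)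
  qed (auto intro: states_compose[OF AA.cstar_algebra_axioms h])
  then have hA: "half_height X B \<pi> \<one>\<^bsub>B\<^esub> = 0"
    by (auto simp: half_height_def s1 A_def[symmetric] intro!: hausdorff_eq_zero bexI)
  have "compose (carrier B) \<phi> (\<lambda>x. x) = \<phi>" if "\<phi> \<in> states B" for \<phi>
    using that by (intro extensionalityI[of _ "carrier B"]) (auto simp: compose_eq states_def)
  then have "{compose (carrier B) \<phi> (\<lambda>x. x) | \<phi>. \<phi> \<in> states B} = states B"
    by (auto intro!: exI)
  then have hB: "half_height Y B (\<lambda>x. x) \<one>\<^bsub>B\<^esub> = 0"
    by (auto simp: half_height_def s1 B_def[symmetric] intro!: hausdorff_eq_zero bexI)
  have zero: "ennreal (cnorm B (\<pi> a \<otimes>\<^bsub>B\<^esub> \<one>\<^bsub>B\<^esub> \<ominus>\<^bsub>B\<^esub> \<one>\<^bsub>B\<^esub> \<otimes>\<^bsub>B\<^esub> \<pi> a)) = 0" if "a \<in> carrier A" for a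
    using that ph(1) by simp
  have sa: "\<pi> a \<in> sa B \<longleftrightarrow> a \<in> sa A" if "a \<in> carrier A" for a
    by (rule star_iso_sa_iff[OF AA.cstar_algebra_axioms p that])
  \<comment> \<open>The partner of \<open>a\<close> is \<open>\<pi> a\<close>: it lies in the other
    Lip-ball since \<open>\<pi>\<close> preserves the Lip-norms, and the pivot 1 makes the distance
    vanish.\<close>
  have "bridge_reach X Y B \<pi> (\<lambda>x. x) \<one>\<^bsub>B\<^esub> = 0"
    unfolding bridge_reach_def A_def[symmetric] B_def[symmetric]
  proof (rule hausdorff_eq_zero)
    fix a assume a: "a \<in> lip_ball A (snd X)"
    then have aA: "a \<in> carrier A" by (simp add: lip_ball_def sa_def)
    have "\<pi> a \<in> lip_ball B (snd Y)" using a aA by (simp add: lip_ball_def sa L)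
    then show "\<exists>t\<in>lip_ball B (snd Y). ennreal (cnorm B (\<pi> a \<otimes>\<^bsub>B\<^esub> \<one>\<^bsub>B\<^esub> \<ominus>\<^bsub>B\<^esub> \<one>\<^bsub>B\<^esub> \<otimes>\<^bsub>B\<^esub> t)) = 0"
      using zero[OF aA] by blast
  next
    fix y assume y: "y \<in> lip_ball B (snd Y)"
    then have "y \<in> carrier B" by (simp add: lip_ball_def sa_def)
    then obtain a where a: "a \<in> carrier A" "y = \<pi> a" using surj by blast
    have "a \<in> sa A" using y a by (simp add: lip_ball_def sa)
    then have "a \<in> lip_ball A (snd X)" using y a L by (simp add: lip_ball_def)
    then show "\<exists>s\<in>lip_ball A (snd X). ennreal (cnorm B (\<pi> s \<otimes>\<^bsub>B\<^esub> \<one>\<^bsub>B\<^esub> \<ominus>\<^bsub>B\<^esub> \<one>\<^bsub>B\<^esub> \<otimes>\<^bsub>B\<^esub> y)) = 0"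
      using zero[OF a(1)] a(2) by blast
  qed
  then have "bridge_length X Y B \<pi> (\<lambda>x. x) \<one>\<^bsub>B\<^esub> = 0"
    by (simp add: bridge_length_def bridge_height_def hA hB)
  moreover have "bridge_chain C D X Y (bridge_length X Y B \<pi> (\<lambda>x. x) \<one>\<^bsub>B\<^esub>)"
    using bridge by (intro bridge_chain.single) (simp add: A_def B_def)
  ultimately have "0 \<in> {l. bridge_chain C D X Y l}" by simp
  then show ?thesis unfolding propinquity_def by (metis Inf_lower le_zero_eq)
qed

theorem corollary5p5:
  fixes A B :: "'u cstar"
    and U V :: "nat \<Rightarrow> 'u set"
    and \<beta> :: "nat \<Rightarrow> real"
    and \<phi> :: "'u \<Rightarrow> 'u"
  assumes "cstar_algebra A" and "af_sequence A U"
    and "cstar_algebra B" and "af_sequence B V"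
    and "\<And>n. 0 < \<beta> n" and "\<beta> \<longlonglongrightarrow> 0"
    and "\<phi> \<in> star_mono A B"
    and "\<And>n. \<phi> ` U n = V n"
  shows "(\<exists>\<pi>. quantum_isometry (A, lip_closed A U \<beta>) (B, lip_closed B V \<beta>) \<pi>) \<and>
    propinquity 1 0 (A, lip_closed A U \<beta>) (B, lip_closed B V \<beta>) = 0 \<and>
    (\<forall>n. propinquity 1 0 (A\<lparr>carrier := U n\<rparr>, lip_closed A U \<beta>)
                         (B\<lparr>carrier := V n\<rparr>, lip_closed B V \<beta>) = 0)"
proof -
  interpret AA: cstar_algebra A by fact
  interpret BB: cstar_algebra B by fact
  obtain \<pi> where \<pi>: "\<pi> \<in> star_iso A B" "\<And>x. x \<in> carrier A \<Longrightarrow> cnorm B (\<pi> x) = cnorm A x"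
    "\<And>n x. x \<in> U n \<Longrightarrow> \<pi> x = \<phi> x"
    using af_star_iso[OF assms(1-4,7,8)] by metis
  have subU: "unital_cstar_subalgebra (U n) A" and subV: "unital_cstar_subalgebra (V n) B"
    and finV: "finite_dimensional (B\<lparr>carrier := V n\<rparr>)" for n
    using assms(2,4) by (auto simp: af_sequence_def)
  have UA: "U n \<subseteq> carrier A" for n by (rule AA.subalgebra_closed(1)[OF subU])
  \<comment> \<open>\<open>\<pi>\<close> agrees with \<open>\<phi>\<close> on each
    \<open>U n\<close>, so it carries one filtration to the other.\<close>
  have VU: "V n = \<pi> ` U n" for n using assms(8)[of n] \<pi>(3) by force
  have L: "lip_closed B V \<beta> (\<pi> a) = lip_closed A U \<beta> a" if "a \<in> carrier A" for a
    by (rule lip_closed_star_iso[OF assms(1,3) \<pi>(1,2) UA VU that])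
  have iso: "quantum_isometry (A, lip_closed A U \<beta>) (B, lip_closed B V \<beta>) \<pi>"
    using \<pi>(1) L by (simp add: quantum_isometry_def sa_def)
  have isoM: "\<pi> \<in> star_mono A B" using \<pi>(1) by (auto simp: star_iso_def star_mono_def bij_betw_def)
  \<comment> \<open>The Lip-norms on the subalgebras are those of \<open>A\<close> and
    \<open>B\<close>, merely restricted, so \<open>L\<close> applies unchanged to the restriction of
    \<open>\<pi>\<close>.\<close>
  have "quantum_isometry (A\<lparr>carrier := U n\<rparr>, lip_closed A U \<beta>) (B\<lparr>carrier := V n\<rparr>, lip_closed B V \<beta>) \<pi>" for n
    using star_iso_restrict[OF isoM UA VU[symmetric], of n] L UA[of n]
    by (auto simp: quantum_isometry_def sa_def)
  moreover have "states (B\<lparr>carrier := V n\<rparr>) \<noteq> {}" for n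
    using finite_dimensional_state[OF BB.cstar_algebra_subalgebra[OF subV] finV, of n] by blast
  ultimately have "propinquity 1 0 (A\<lparr>carrier := U n\<rparr>, lip_closed A U \<beta>)
      (B\<lparr>carrier := V n\<rparr>, lip_closed B V \<beta>) = 0" for n
    by (intro propinquity_quantum_isometry[where \<pi> = \<pi>])
       (auto intro: AA.cstar_algebra_subalgebra[OF subU] BB.cstar_algebra_subalgebra[OF subV])
  moreover have "propinquity 1 0 (A, lip_closed A U \<beta>) (B, lip_closed B V \<beta>) = 0"
    using assms(1,3) BB.af_algebra_states_nonempty[OF assms(4)]
    by (intro propinquity_quantum_isometry[OF _ _ _ iso]) auto
  ultimately show ?thesis using iso by blast
qed

end
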